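(* Let $n$ be prime and let $G$ be a connected graph on $n$ vertices. Then $G$ is Laplacian integral if and only if there exist connected Laplacian integral graphs $G_1, G_2, \ldots, G_d$ (with $d \geq 2$) such that $$G = (G_1 \sqcup G_2 \sqcup \cdots \sqcup G_d)^{\mathrm{c}}.$$ Furthermore, $G$ is $\{-1,0,1\}$-diagonalizable if and only if $G$ has such a decomposition in which $G_1, G_2, \ldots, G_d$ are $\{-1,0,1\}$-diagonalizable and the vector $(|V(G_1)|, |V(G_2)|, \ldots, |V(G_d)|)$ is balanced.
   Context: All graphs are finite, simple, undirected, unweighted, and loopless. For a graph $G$, $L(G) = D(G) - A(G)$ is its Laplacian matrix (diagonal degree matrix minus adjacency matrix), $G^{\mathrm{c}}$ is its complement, and $\sqcup$ denotes disjoint union of graphs. Equality of graphs is up to isomorphism. $G$ is Laplacian integral if all eigenvalues of $L(G)$ are integers. $G$ is $\{-1,0,1\}$-diagonalizable if there is a basis of eigenvectors of $L(G)$ whose entries all belong to $\{-1,0,1\}$; equivalently, there is an invertible matrix $P$ with all entries in $\{-1,0,1\}$ such that $P^{-1}L(G)P$ is diagonal. A vector $\mathbf{v} \in \mathbb{R}^d$ with $d \geq 2$ is balanced if there exists a $(d-1)\times d$ matrix $A$, all of whose entries belong to $\{-1,0,1\}$, with $\mathrm{null}(A) = \mathrm{span}(\mathbf{v})$. (For $d=1$, every $\mathbf{v}\in\mathbb{R}^1$ is declared balanced.) *)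

theory Defs
  imports
    "Graph_Theory.Graph_Theory"
    "Jordan_Normal_Form.Char_Poly"
    "Jordan_Normal_Form.Matrix_Kernel"
    "HOL-Computational_Algebra.Primes"
begin

text \<open>
  A finite simple undirected graph is a \<^locale>\<open>pair_graph\<close>: a finite, loopfree digraph whose
  arc set is a symmetric set of pairs, so an edge is a pair of opposite arcs and the degree of a
  vertex is its out-degree.
\<close>

definition graph_complement :: "'a pair_pre_digraph \<Rightarrow> 'a pair_pre_digraph" where
  "graph_complement G =
    \<lparr> pverts = pverts G,
      parcs = {(u, v). u \<in> pverts G \<and> v \<in> pverts G \<and> u \<noteq> v \<and> (u, v) \<notin> parcs G} \<rparr>"

definition disjoint_union :: "'a pair_pre_digraph list \<Rightarrow> (nat \<times> 'a) pair_pre_digraph" where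
  "disjoint_union Gs =
    \<lparr> pverts = {(i, v). i < length Gs \<and> v \<in> pverts (Gs ! i)},
      parcs = {((i, u), (j, v)). i < length Gs \<and> j = i \<and> (u, v) \<in> parcs (Gs ! i)} \<rparr>"

text \<open>
  Matrices of a graph are indexed by positions in a list \<open>vs\<close> enumerating its vertices.
\<close>

definition vertex_enumeration :: "'a pair_pre_digraph \<Rightarrow> 'a list \<Rightarrow> bool" where
  "vertex_enumeration G vs \<longleftrightarrow> distinct vs \<and> set vs = pverts G"

definition degree_matrix :: "'a pair_pre_digraph \<Rightarrow> 'a list \<Rightarrow> real mat" where
  "degree_matrix G vs = mat (length vs) (length vs)
    (\<lambda>(i, j). if i = j then real (out_degree (with_proj G) (vs ! i)) else 0)"

definition adjacency_matrix :: "'a pair_pre_digraph \<Rightarrow> 'a list \<Rightarrow> real mat" where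
  "adjacency_matrix G vs = mat (length vs) (length vs)
    (\<lambda>(i, j). if (vs ! i, vs ! j) \<in> parcs G then 1 else 0)"

definition laplacian_matrix :: "'a pair_pre_digraph \<Rightarrow> 'a list \<Rightarrow> real mat" where
  "laplacian_matrix G vs = degree_matrix G vs - adjacency_matrix G vs"

text \<open>
  The two properties below do not depend on the enumeration, because Laplacian matrices for
  different enumerations are conjugate by permutation matrices. The first one ranges over all complex
  eigenvalues; those of a real symmetric matrix are real, so they are the same as the real ones.
\<close>

definition laplacian_integral :: "'a pair_pre_digraph \<Rightarrow> bool" where
  "laplacian_integral G \<longleftrightarrow>
    (\<forall>vs. vertex_enumeration G vs \<longrightarrow>
      (\<forall>k. eigenvalue (map_mat complex_of_real (laplacian_matrix G vs)) k \<longrightarrow> k \<in> \<int>))"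

text \<open>
  \<open>similar_mat_wit L D P Q\<close> states that \<open>Q\<close> is the inverse of \<open>P\<close> and \<open>L = P * D * Q\<close>; the columns
  of \<open>P\<close> then form a basis of eigenvectors of \<open>L\<close>.
\<close>

definition signed_diagonalizable :: "'a pair_pre_digraph \<Rightarrow> bool" where
  "signed_diagonalizable G \<longleftrightarrow>
    (\<forall>vs. vertex_enumeration G vs \<longrightarrow>
      (\<exists>P Q D. similar_mat_wit (laplacian_matrix G vs) D P Q \<and> diagonal_mat D \<and>
        elements_mat P \<subseteq> {-1, 0, 1}))"

definition balanced :: "real vec \<Rightarrow> bool" where
  "balanced v \<longleftrightarrow> dim_vec v = 1 \<or>
    (dim_vec v \<ge> 2 \<and>
      (\<exists>A \<in> carrier_mat (dim_vec v - 1) (dim_vec v).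
        elements_mat A \<subseteq> {-1, 0, 1} \<and>
        mat_kernel A = module.span class_ring (module_vec TYPE(real) (dim_vec v)) {v}))"

text \<open>
  The summands may be taken on subsets of \<^typ>\<open>nat\<close>, since every finite graph is isomorphic to
  such a graph.
\<close>

definition integral_decomposition :: "'a pair_pre_digraph \<Rightarrow> nat pair_pre_digraph list \<Rightarrow> bool" where
  "integral_decomposition G Gs \<longleftrightarrow>
    length Gs \<ge> 2 \<and>
    (\<forall>H \<in> set Gs. pair_graph H \<and> Digraph_Component.connected (with_proj H) \<and> laplacian_integral H) \<and>
    digraph_iso (with_proj G) (with_proj (graph_complement (disjoint_union Gs)))"

end

theory Submission
  imports Defs
begin

text \<open>
All of the argument takes place in the space of functions on the vertices, on which the Laplacian
acts by \<open>f \<mapsto> (u \<mapsto> \<Sum>w\<sim>u. f u - f w)\<close>. It is self-adjoint, the constants are harmonic, and on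
functions of sum zero the Laplacians of a graph on \<open>n\<close> vertices and of its complement add up to \<open>n\<close>.
So complementation replaces an eigenvalue \<open>k\<close> on such functions by \<open>n - k\<close>, while a disjoint union
acts on each summand separately; this makes complements of disjoint unions of integral graphs
integral.

For the converse let \<open>n\<close> be prime and \<open>G\<close> connected and integral. By the quadratic form the nonzero
eigenvalues lie in \<open>{1..n}\<close>. Add \<open>1\<close> to every entry of the first row of the Laplacian matrix. The
resulting integer matrix \<open>K\<close> maps the all-ones vector to \<open>n\<close> times a unit vector, so \<open>n\<close> divides
\<open>det K\<close>; and its eigenvalues are \<open>1\<close> or nonzero Laplacian eigenvalues of \<open>G\<close>. Their product is
\<open>det K\<close>, so the prime \<open>n\<close> divides one of them, which must then equal \<open>n\<close>
(\<open>prime_integral_top_eigenvalue\<close>). An eigenfunction for \<open>n\<close> has sum zero and is harmonic on the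
complement; were the complement connected, it would be constant, hence zero. The summands \<open>G\<^sub>i\<close> are
the connected components of the complement.

For \<open>{-1,0,1}\<close>-diagonalizability, call a function with values in \<open>{-1,0,1}\<close> signed. A spanning set
contains a basis, so the property says that the signed eigenfunctions span, or dually that only the
zero function is orthogonal to all of them (\<open>signed_diagonalizable_iff\<close>). Likewise a vector \<open>v\<close> is
balanced iff every vector that is orthogonal to all signed vectors in the orthogonal complement of
\<open>v\<close> is a multiple of \<open>v\<close> (\<open>balanced_iff_orthogonal\<close>). Both criteria are basis-free, and with them the
equivalence comes down to the following description of the eigenfunctions of the complement of
\<open>G\<^sub>1 \<squnion> \<dots> \<squnion> G\<^sub>d\<close>: the constants; the functions that are constant on each part and have sum zero, for
the eigenvalue \<open>n\<close>, that is, the vectors orthogonal to the vector of part sizes; and the functions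
whose restriction to each part is zero or an eigenfunction for one common nonzero eigenvalue.
Restricting signed eigenfunctions to the parts, and extending or lifting them back, gives both
directions (\<open>signed_complete_complement_union_iff\<close>). Finally, a graph whose signed eigenfunctions span
has only integer eigenvalues, since an integer matrix applied to a vector with an entry \<open>\<plusminus>1\<close> and
integer entries shows that the eigenvalue is an integer; so diagonalizability already provides the
integral decomposition.
\<close>

section \<open>Separating sets of vectors and balanced vectors\<close>

text \<open>
The dual form of spanning the space of vectors of length \<open>m\<close>. Speaking about scalar products only,
it can be verified without writing vectors as linear combinations.
\<close>

definition separating :: "nat \<Rightarrow> 'a::field vec set \<Rightarrow> bool" where
  "separating m S \<longleftrightarrow> (\<forall>y\<in>carrier_vec m. (\<forall>s\<in>S. s \<bullet> y = 0) \<longrightarrow> y = 0\<^sub>v m)"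

lemma separatingD:
  "separating m S \<Longrightarrow> y \<in> carrier_vec m \<Longrightarrow> (\<And>s. s \<in> S \<Longrightarrow> s \<bullet> y = 0) \<Longrightarrow> y = 0\<^sub>v m"
  by (auto simp: separating_def)

text \<open>
Appending zero rows gives a square matrix with a zero row, hence of determinant zero and with the
same kernel.
\<close>

lemma wide_matrix_kernel_nontrivial:
  fixes A :: "'a::field mat"
  assumes A: "A \<in> carrier_mat nr nc" and "nr < nc"
  shows "\<exists>v\<in>carrier_vec nc. v \<noteq> 0\<^sub>v nc \<and> A *\<^sub>v v = 0\<^sub>v nr"
proof -
  define B where "B = mat nc nc (\<lambda>(i,j). if i < nr then A $$ (i,j) else 0)"
  have B: "B \<in> carrier_mat nc nc" by (simp add: B_def)
  have "B\<^sup>T *\<^sub>v unit_vec nc nr = 0\<^sub>v nc"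
    using \<open>nr < nc\<close> B by (intro eq_vecI) (auto simp: B_def)
  moreover have "unit_vec nc nr \<noteq> (0\<^sub>v nc :: 'a vec)" using \<open>nr < nc\<close> by simp
  ultimately have "det B\<^sup>T = 0"
    using B det_0_iff_vec_prod_zero[of "B\<^sup>T" nc] by (metis transpose_carrier_mat unit_vec_carrier)
  then have "det B = 0" using det_transpose[OF B] by simp
  then obtain v where v: "v \<in> carrier_vec nc" "v \<noteq> 0\<^sub>v nc" "B *\<^sub>v v = 0\<^sub>v nc"
    using det_0_iff_vec_prod_zero[OF B] by auto
  have "(A *\<^sub>v v) $ i = 0" if "i < nr" for i
  proof -
    have "row A i = row B i"
      using that A \<open>nr < nc\<close> by (intro eq_vecI) (auto simp: B_def)
    then have "(A *\<^sub>v v) $ i = (B *\<^sub>v v) $ i" using that \<open>nr < nc\<close> A B by simp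
    then show ?thesis using v that \<open>nr < nc\<close> by simp
  qed
  then have "A *\<^sub>v v = 0\<^sub>v nr" using A by (intro eq_vecI) auto
  then show ?thesis using v by blast
qed

text \<open>
A separating set of more than \<open>m\<close> vectors satisfies a nontrivial linear relation, so one of its
vectors can be dropped; fewer than \<open>m\<close> vectors have a common nonzero orthogonal vector.
\<close>

lemma separating_contains_basis:
  fixes S :: "'a::field vec set"
  assumes "finite S" "S \<subseteq> carrier_vec m" "separating m S"
  shows "\<exists>B\<subseteq>S. separating m B \<and> card B = m"
  using assms
proof (induction "card S" arbitrary: S rule: less_induct)
  case less
  obtain vs where vs: "set vs = S" "distinct vs"
    using finite_distinct_list[OF \<open>finite S\<close>] by blast
  have len: "length vs = card S" using vs distinct_card by metis
  have vs_carrier: "set vs \<subseteq> carrier_vec m" using less.prems vs by simp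
  consider "card S < m" | "card S = m" | "card S > m" by linarith
  then show ?case
  proof cases
    case 1
    have M: "mat_of_rows m vs \<in> carrier_mat (card S) m" by (intro carrier_matI) (simp_all only: len mat_of_rows_carrier mat_of_cols_carrier)
    obtain v where v: "v \<in> carrier_vec m" "v \<noteq> 0\<^sub>v m" "mat_of_rows m vs *\<^sub>v v = 0\<^sub>v (card S)"
      using wide_matrix_kernel_nontrivial[OF M 1] by blast
    have "s \<bullet> v = 0" if s: "s \<in> S" for s
    proof -
      obtain i where i: "i < card S" "s = vs ! i" using s in_set_conv_nth[of s vs] vs(1) len by auto
      then have "vs ! i \<in> carrier_vec m" using vs_carrier len by (metis nth_mem subsetD)
      then have "s \<bullet> v = (mat_of_rows m vs *\<^sub>v v) $ i" using i len by simp
      then show ?thesis using v i by simp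
    qed
    then show ?thesis using separatingD[OF less.prems(3) v(1)] v(2) by blast
  next
    case 2
    then show ?thesis using less.prems by blast
  next
    case 3
    have M: "mat_of_cols m vs \<in> carrier_mat m (card S)" by (intro carrier_matI) (simp_all only: len mat_of_rows_carrier mat_of_cols_carrier)
    obtain c where c: "c \<in> carrier_vec (card S)" "c \<noteq> 0\<^sub>v (card S)" "mat_of_cols m vs *\<^sub>v c = 0\<^sub>v m"
      using wide_matrix_kernel_nontrivial[OF M 3] by blast
    obtain k where k: "k < card S" "c $ k \<noteq> 0" using c(1,2) by (metis carrier_vecD eq_vecI index_zero_vec)
    \<comment> \<open>The relation with coefficients c expresses vs ! k, up to the factor c $ k, by the other vectors.\<close>
    have "separating m (S - {vs ! k})" unfolding separating_def
    proof (intro ballI impI)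
      fix y :: "'a vec" assume y: "y \<in> carrier_vec m" and orth: "\<forall>s\<in>S - {vs ! k}. s \<bullet> y = 0"
      have "(mat_of_cols m vs *\<^sub>v c) $ j = (\<Sum>i<card S. vs ! i $ j * c $ i)" if "j < m" for j
        using that c(1) len by (simp add: scalar_prod_def mat_of_cols_index atLeast0LessThan)
      then have zero: "(\<Sum>i<card S. vs ! i $ j * c $ i) = 0" if "j < m" for j
        using that c(3) by (metis index_zero_vec(1))
      have "(\<Sum>i<card S. c $ i * (vs ! i \<bullet> y)) = (\<Sum>i<card S. \<Sum>j<m. vs ! i $ j * c $ i * y $ j)"
        using y by (simp add: scalar_prod_def atLeast0LessThan sum_distrib_left ac_simps)
      also have "\<dots> = (\<Sum>j<m. (\<Sum>i<card S. vs ! i $ j * c $ i) * y $ j)"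
        by (subst sum.swap) (simp add: sum_distrib_right)
      also have "\<dots> = 0" using zero by simp
      finally have "(\<Sum>i<card S. c $ i * (vs ! i \<bullet> y)) = 0" .
      moreover have "vs ! i \<bullet> y = 0" if "i < card S" "i \<noteq> k" for i
      proof -
        have "vs ! i \<in> S" using vs(1) len that(1) by (metis nth_mem)
        moreover have "vs ! i \<noteq> vs ! k" using nth_eq_iff_index_eq[OF vs(2)] that k(1) len by auto
        ultimately show ?thesis using orth by blast
      qed
      then have "(\<Sum>i<card S. c $ i * (vs ! i \<bullet> y)) = (\<Sum>i\<in>{k}. c $ i * (vs ! i \<bullet> y))"
        using k by (intro sum.mono_neutral_right) auto
      ultimately have "vs ! k \<bullet> y = 0" using k by simp
      then have "s \<bullet> y = 0" if "s \<in> S" for s using orth that by (cases "s = vs ! k") auto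
      then show "y = 0\<^sub>v m" using separatingD[OF less.prems(3) y] by blast
    qed
    moreover have "vs ! k \<in> S" using vs len k nth_mem by metis
    then have "card (S - {vs ! k}) < card S"
      using \<open>finite S\<close> by (intro card_Diff1_less)
    ultimately show ?thesis
      using less.hyps[of "S - {vs ! k}"] less.prems by (meson Diff_subset finite_Diff subset_trans)
  qed
qed

lemma finite_vectors_over:
  assumes "finite F"
  shows "finite {v \<in> carrier_vec m. \<forall>i<m. v $ i \<in> F}"
proof -
  have "{v \<in> carrier_vec m. \<forall>i<m. v $ i \<in> F} \<subseteq> vec_of_list ` {xs. set xs \<subseteq> F \<and> length xs = m}"
  proof
    fix v assume "v \<in> {v \<in> carrier_vec m. \<forall>i<m. v $ i \<in> F}"
    then have v: "dim_vec v = m" "\<And>i. i < m \<Longrightarrow> v $ i \<in> F" by auto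
    then have "set (list_of_vec v) \<subseteq> F" by (auto simp: in_set_conv_nth)
    then show "v \<in> vec_of_list ` {xs. set xs \<subseteq> F \<and> length xs = m}"
      using v(1) by (intro rev_image_eqI[of "list_of_vec v"]) (simp_all add: vec_list)
  qed
  then show ?thesis by (rule finite_subset) (simp add: finite_lists_length_eq[OF assms])
qed

lemma separating_columns_invertible:
  fixes bs :: "'a::field vec list"
  assumes carrier: "set bs \<subseteq> carrier_vec m" and len: "length bs = m" and sep: "separating m (set bs)"
  obtains Q where "Q \<in> carrier_mat m m" "mat_of_cols m bs * Q = 1\<^sub>m m" "Q * mat_of_cols m bs = 1\<^sub>m m"
proof -
  have R: "mat_of_rows m bs \<in> carrier_mat m m" by (intro carrier_matI) (simp_all only: len mat_of_rows_carrier mat_of_cols_carrier)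
  have "det (mat_of_rows m bs) \<noteq> 0"
  proof
    assume "det (mat_of_rows m bs) = 0"
    then obtain v where v: "v \<in> carrier_vec m" "v \<noteq> 0\<^sub>v m" "mat_of_rows m bs *\<^sub>v v = 0\<^sub>v m"
      using det_0_iff_vec_prod_zero[OF R] by blast
    have "s \<bullet> v = 0" if s: "s \<in> set bs" for s
    proof -
      obtain i where i: "i < m" "s = bs ! i" using s in_set_conv_nth[of s bs] len by auto
      then have "bs ! i \<in> carrier_vec m" using carrier len by (metis nth_mem subsetD)
      then have "s \<bullet> v = (mat_of_rows m bs *\<^sub>v v) $ i" using i len by simp
      then show ?thesis using v i by simp
    qed
    then show False using separatingD[OF sep v(1)] v(2) by blast
  qed
  then have "det (mat_of_cols m bs) \<noteq> 0"
    using det_transpose[OF R] by (simp add: transpose_mat_of_rows)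
  moreover have C: "mat_of_cols m bs \<in> carrier_mat m m" by (intro carrier_matI) (simp_all only: len mat_of_rows_carrier mat_of_cols_carrier)
  ultimately show ?thesis
    using det_non_zero_imp_unit[OF C, of "()"] that
    by (auto simp: Units_def ring_mat_def)
qed

lemma span_singleton_vec:
  fixes v :: "real vec"
  assumes "v \<in> carrier_vec d"
  shows "module.span class_ring (module_vec TYPE(real) d) {v} = {c \<cdot>\<^sub>v v | c. True}"
proof -
  interpret vec_space "TYPE(real)" d .
  show ?thesis
  proof (intro equalityI subsetI)
    fix x assume "x \<in> span {v}"
    then obtain a A where x: "x = lincomb a A" "A \<subseteq> {v}" using in_spanE by blast
    have A: "finite A" "A \<subseteq> carrier_vec d" using x(2) assms finite_subset by auto
    have "x = (if A = {} then 0 else a v) \<cdot>\<^sub>v v"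
    proof (intro eq_vecI)
      show "dim_vec x = dim_vec ((if A = {} then 0 else a v) \<cdot>\<^sub>v v)"
        using x(1) assms lincomb_dim[OF A, of a] by simp
      fix i assume "i < dim_vec ((if A = {} then 0 else a v) \<cdot>\<^sub>v v)"
      then have i: "i < d" using assms by simp
      consider "A = {}" | "A = {v}" using x(2) by blast
      then show "x $ i = ((if A = {} then 0 else a v) \<cdot>\<^sub>v v) $ i"
        using x assms i lincomb_index[OF i, of A a] by cases auto
    qed
    then show "x \<in> {c \<cdot>\<^sub>v v | c. True}" by blast
  next
    fix x assume "x \<in> {c \<cdot>\<^sub>v v | c. True}"
    then show "x \<in> span {v}" using assms smult_in_span[of "{v}" v] in_own_span[of "{v}"] by auto
  qed
qed

text \<open>
A matrix shows \<open>v\<close> to be balanced if its rows are signed vectors orthogonal to \<open>v\<close> and only the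
multiples of \<open>v\<close> are orthogonal to all rows. Such a matrix with \<open>d - 1\<close> rows exists as soon as all
signed vectors orthogonal to \<open>v\<close> together leave only the multiples of \<open>v\<close>: adding \<open>v\<close> to them gives a separating
set, and a basis chosen from it consists of \<open>v\<close> and of \<open>d - 1\<close> of these vectors.
\<close>

lemma balanced_iff_orthogonal:
  assumes v: "v \<in> carrier_vec d" and "d \<ge> 2" and "v \<noteq> 0\<^sub>v d"
  shows "balanced v \<longleftrightarrow>
    (\<forall>y\<in>carrier_vec d.
      (\<forall>a\<in>carrier_vec d. (\<forall>i<d. a $ i \<in> {-1,0,1}) \<longrightarrow> a \<bullet> v = 0 \<longrightarrow> a \<bullet> y = 0) \<longrightarrow>
      (\<exists>c. y = c \<cdot>\<^sub>v v))" (is "_ \<longleftrightarrow> ?R")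
proof
  assume "balanced v"
  then obtain A where A: "A \<in> carrier_mat (d - 1) d" "elements_mat A \<subseteq> {-1,0,1}"
    and ker: "mat_kernel A = {c \<cdot>\<^sub>v v | c. True}"
    using assms span_singleton_vec[OF v] by (auto simp: balanced_def)
  have "v \<in> mat_kernel A" unfolding ker by (auto intro!: exI[of _ 1])
  then have Av: "A *\<^sub>v v = 0\<^sub>v (d - 1)" using mat_kernelD[OF A(1)] by blast
  show ?R
  proof (intro ballI impI)
    fix y assume y: "y \<in> carrier_vec d"
      and orth: "\<forall>a\<in>carrier_vec d. (\<forall>i<d. a $ i \<in> {-1,0,1}) \<longrightarrow> a \<bullet> v = 0 \<longrightarrow> a \<bullet> y = 0"
    have "(A *\<^sub>v y) $ i = 0" if i: "i < d - 1" for i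
    proof -
      have "\<forall>j<d. row A i $ j \<in> {-1,0,1}" using A i by (metis carrier_matD elements_matI index_row(1) subsetD)
      moreover have "row A i \<bullet> v = 0" using Av A i by (metis carrier_matD(1) index_mult_mat_vec index_zero_vec(1))
      ultimately have "row A i \<bullet> y = 0" using orth A(1) by (metis carrier_matD(2) row_carrier)
      then show ?thesis using A i by simp
    qed
    then have "A *\<^sub>v y = 0\<^sub>v (d - 1)" using A by (intro eq_vecI) auto
    then have "y \<in> mat_kernel A" using A y by (intro mat_kernelI)
    then show "\<exists>c. y = c \<cdot>\<^sub>v v" using ker by blast
  qed
next
  assume R: ?R
  have vv: "v \<bullet> v \<noteq> 0"
  proof
    assume "v \<bullet> v = 0"
    then have "\<forall>i\<in>{0..<d}. v $ i * v $ i = 0"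
      using v by (subst sum_nonneg_eq_0_iff[symmetric]) (auto simp: scalar_prod_def)
    then show False using v \<open>v \<noteq> 0\<^sub>v d\<close> by (auto intro!: eq_vecI)
  qed
  define T where "T = {a \<in> carrier_vec d. (\<forall>i<d. a $ i \<in> {-1,0,1::real}) \<and> a \<bullet> v = 0}"
  have "finite T" unfolding T_def
    by (rule finite_subset[OF _ finite_vectors_over[of "{-1,0,1::real}" d]]) auto
  have "v \<notin> T" using vv by (simp add: T_def)
  have "separating d (insert v T)" unfolding separating_def
  proof (intro ballI impI)
    fix y assume y: "y \<in> carrier_vec d" and orth: "\<forall>s\<in>insert v T. s \<bullet> y = 0"
    then obtain c where "y = c \<cdot>\<^sub>v v" using R by (auto simp: T_def)
    moreover have "v \<bullet> y = 0" using orth by simp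
    ultimately have "c = 0" using v vv by simp
    then show "y = 0\<^sub>v d" using \<open>y = _\<close> v by auto
  qed
  then obtain B where B: "B \<subseteq> insert v T" "separating d B" "card B = d"
    using separating_contains_basis[of "insert v T" d] \<open>finite T\<close> v by (auto simp: T_def)
  \<comment> \<open>All elements of T are orthogonal to v, so T alone does not separate.\<close>
  have "v \<in> B"
  proof (rule ccontr)
    assume "v \<notin> B"
    then have "\<And>s. s \<in> B \<Longrightarrow> s \<bullet> v = 0" using B(1) by (auto simp: T_def)
    then show False using separatingD[OF B(2) v] \<open>v \<noteq> 0\<^sub>v d\<close> by blast
  qed
  have finB: "finite B" using \<open>finite T\<close> B(1) finite_subset by blast
  then obtain as where as: "set as = B - {v}" "distinct as"
    using finite_distinct_list by (metis finite_Diff)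
  have len: "length as = d - 1" using as B(3) \<open>v \<in> B\<close> finB
    by (metis card_Diff_singleton distinct_card)
  have asT: "set as \<subseteq> T" using as B(1) by auto
  then have carrier: "set as \<subseteq> carrier_vec d" by (auto simp: T_def)
  define A where "A = mat_of_rows d as"
  have A: "A \<in> carrier_mat (d - 1) d" unfolding A_def by (intro carrier_matI) (simp_all only: len mat_of_rows_carrier mat_of_cols_carrier)
  have row_A: "row A i = as ! i" if "i < d - 1" for i
    unfolding A_def using that carrier len by (intro mat_of_rows_row) (metis, metis nth_mem subsetD)
  have asD: "as ! i \<in> T" if "i < d - 1" for i using that asT len by (metis nth_mem subsetD)
  have "elements_mat A \<subseteq> {-1,0,1}"
  proof
    fix x assume "x \<in> elements_mat A"
    then obtain i j where "i < d - 1" "j < d" "x = A $$ (i,j)" using A by auto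
    then show "x \<in> {-1,0,1}" using asD[of i] len by (auto simp: A_def mat_of_rows_index T_def)
  qed
  moreover have "mat_kernel A = {c \<cdot>\<^sub>v v | c. True}"
  proof (intro equalityI subsetI)
    fix x assume "x \<in> {c \<cdot>\<^sub>v v | c. True}"
    then obtain c where x: "x = c \<cdot>\<^sub>v v" by blast
    have "A *\<^sub>v x = 0\<^sub>v (d - 1)"
      using A asD v by (intro eq_vecI) (auto simp: x row_A T_def)
    then show "x \<in> mat_kernel A" using A v x by (intro mat_kernelI) auto
  next
    fix x assume "x \<in> mat_kernel A"
    then have x: "x \<in> carrier_vec d" "A *\<^sub>v x = 0\<^sub>v (d - 1)" using mat_kernelD[OF A] by auto
    \<comment> \<open>Subtracting the projection to v leaves a vector orthogonal to v and to all rows, hence zero.\<close>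
    define c where "c = (v \<bullet> x) / (v \<bullet> v)"
    have "x - c \<cdot>\<^sub>v v = 0\<^sub>v d"
    proof (rule separatingD[OF B(2)])
      show "x - c \<cdot>\<^sub>v v \<in> carrier_vec d" using x v by simp
      fix s assume s: "s \<in> B"
      then have sc: "s \<in> carrier_vec d" using B(1) v by (auto simp: T_def)
      have *: "s \<bullet> (x - c \<cdot>\<^sub>v v) = s \<bullet> x - c * (s \<bullet> v)"
        using x v sc by (simp add: scalar_prod_minus_distrib)
      show "s \<bullet> (x - c \<cdot>\<^sub>v v) = 0"
      proof (cases "s = v")
        case True
        then show ?thesis unfolding * using vv by (simp add: c_def)
      next
        case False
        then have "s \<in> set as" using s as by simp
        then obtain i where i: "i < d - 1" "s = as ! i" using in_set_conv_nth[of s as] len by auto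
        then have "s \<bullet> x = (A *\<^sub>v x) $ i" using A row_A by simp
        then have "s \<bullet> x = 0" using x i by simp
        moreover have "s \<bullet> v = 0" using asD i by (auto simp: T_def)
        ultimately show ?thesis unfolding * by simp
      qed
    qed
    then have "x = c \<cdot>\<^sub>v v" using x v
      by (intro eq_vecI) (auto simp: vec_eq_iff)
    then show "x \<in> {c \<cdot>\<^sub>v v | c. True}" by blast
  qed
  ultimately show "balanced v"
    using A assms span_singleton_vec[OF v] by (auto simp: balanced_def)
qed

section \<open>The Laplacian as an operator on functions\<close>

definition laplacian :: "'a pair_pre_digraph \<Rightarrow> ('a \<Rightarrow> 'b::comm_ring_1) \<Rightarrow> 'a \<Rightarrow> 'b" where
  "laplacian H f u = (\<Sum>w\<in>pverts H. if (u, w) \<in> parcs H then f u - f w else 0)"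

definition eigenfunction :: "'a pair_pre_digraph \<Rightarrow> 'b::comm_ring_1 \<Rightarrow> ('a \<Rightarrow> 'b) \<Rightarrow> bool" where
  "eigenfunction H k f \<longleftrightarrow> (\<forall>u\<in>pverts H. laplacian H f u = k * f u)"

definition signed_eigenfunction :: "'a pair_pre_digraph \<Rightarrow> real \<Rightarrow> ('a \<Rightarrow> real) \<Rightarrow> bool" where
  "signed_eigenfunction H k f \<longleftrightarrow> eigenfunction H k f \<and> (\<forall>u\<in>pverts H. f u \<in> {-1,0,1})"

lemma eigenfunctionD: "eigenfunction H k f \<Longrightarrow> u \<in> pverts H \<Longrightarrow> laplacian H f u = k * f u"
  by (simp add: eigenfunction_def)

lemma laplacian_cong:
  assumes "\<And>w. w \<in> pverts H \<Longrightarrow> f w = g w" "u \<in> pverts H"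
  shows "laplacian H f u = laplacian H g u"
  unfolding laplacian_def using assms by (intro sum.cong) auto

lemma eigenfunction_cong:
  assumes "\<And>w. w \<in> pverts H \<Longrightarrow> f w = g w"
  shows "eigenfunction H k f \<longleftrightarrow> eigenfunction H k g"
  unfolding eigenfunction_def using assms laplacian_cong[of H f g] by auto

lemma pair_graph_arcs:
  assumes "pair_graph H" "(u, v) \<in> parcs H"
  shows "u \<in> pverts H" "v \<in> pverts H" "u \<noteq> v" "(v, u) \<in> parcs H"
proof -
  interpret pair_graph H by fact
  show "u \<in> pverts H" "v \<in> pverts H" "u \<noteq> v" "(v, u) \<in> parcs H"
    using assms(2) in_arcsD1 in_arcsD2 no_loops' arcs_symmetric by blast+
qed

lemma pair_graph_finite: "pair_graph H \<Longrightarrow> finite (pverts H)"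
  by (simp add: pair_fin_digraph.pair_finite_verts pair_graph_def pair_digraph_def)

lemma pair_graphI:
  assumes fin: "finite (pverts H)"
    and arcs: "\<And>u v. (u, v) \<in> parcs H \<Longrightarrow>
      u \<in> pverts H \<and> v \<in> pverts H \<and> u \<noteq> v \<and> (v, u) \<in> parcs H"
  shows "pair_graph H"
proof
  have "parcs H \<subseteq> pverts H \<times> pverts H" using arcs by auto
  then show "finite (parcs H)" using fin finite_subset by blast
  show "symmetric (with_proj H)" using arcs by (auto simp: symmetric_def intro: symI)
qed (use assms in force)+

text \<open>
The Dirichlet form. The double sum runs over ordered pairs, so each edge counts twice; this gives
the factor \<open>2\<close> on the left and avoids division. Symmetry and positivity of the Laplacian are read off
from the right hand side.
\<close>

lemma sum_laplacian_mult:
  assumes "pair_graph H"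
  shows "2 * (\<Sum>u\<in>pverts H. laplacian H f u * g u) =
    (\<Sum>u\<in>pverts H. \<Sum>w\<in>pverts H. if (u, w) \<in> parcs H then (f u - f w) * (g u - g w) else 0)"
proof -
  let ?V = "pverts H" and ?E = "parcs H"
  have 1: "(\<Sum>u\<in>?V. laplacian H f u * g u) =
      (\<Sum>u\<in>?V. \<Sum>w\<in>?V. if (u, w) \<in> ?E then (f u - f w) * g u else 0)"
    unfolding laplacian_def sum_distrib_right by (intro sum.cong) auto
  also have "\<dots> = (\<Sum>u\<in>?V. \<Sum>w\<in>?V. if (w, u) \<in> ?E then (f w - f u) * g w else 0)"
    by (rule sum.swap)
  also have "\<dots> = (\<Sum>u\<in>?V. \<Sum>w\<in>?V. if (u, w) \<in> ?E then (f w - f u) * g w else 0)"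
    using pair_graph_arcs[OF assms] by (intro sum.cong if_cong) auto
  finally have 2: "(\<Sum>u\<in>?V. laplacian H f u * g u) =
      (\<Sum>u\<in>?V. \<Sum>w\<in>?V. if (u, w) \<in> ?E then (f w - f u) * g w else 0)" .
  have "2 * (\<Sum>u\<in>?V. laplacian H f u * g u) =
      (\<Sum>u\<in>?V. \<Sum>w\<in>?V. if (u, w) \<in> ?E then (f u - f w) * g u else 0) +
      (\<Sum>u\<in>?V. \<Sum>w\<in>?V. if (u, w) \<in> ?E then (f w - f u) * g w else 0)"
    unfolding mult_2 by (rule arg_cong2[where f = "(+)", OF 1 2])
  also have "\<dots> = (\<Sum>u\<in>?V. \<Sum>w\<in>?V. if (u, w) \<in> ?E then (f u - f w) * (g u - g w) else 0)"
    unfolding sum.distrib[symmetric] by (intro sum.cong refl) (auto simp: algebra_simps)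
  finally show ?thesis .
qed

lemma laplacian_self_adjoint:
  fixes f g :: "'a \<Rightarrow> 'b::{comm_ring_1,ring_char_0,ring_no_zero_divisors}"
  assumes "pair_graph H"
  shows "(\<Sum>u\<in>pverts H. laplacian H f u * g u) = (\<Sum>u\<in>pverts H. f u * laplacian H g u)"
proof -
  have "2 * (\<Sum>u\<in>pverts H. laplacian H f u * g u) = 2 * (\<Sum>u\<in>pverts H. laplacian H g u * f u)"
    unfolding sum_laplacian_mult[OF assms] by (intro sum.cong refl) (auto simp: mult.commute)
  then show ?thesis by (simp add: mult.commute)
qed

lemma laplacian_const [simp]: "laplacian H (\<lambda>_. c) u = 0"
  by (simp add: laplacian_def cong: if_cong)

lemma sum_laplacian:
  fixes f :: "'a \<Rightarrow> 'b::{comm_ring_1,ring_char_0,ring_no_zero_divisors}"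
  assumes "pair_graph H"
  shows "(\<Sum>u\<in>pverts H. laplacian H f u) = 0"
  using laplacian_self_adjoint[OF assms, of f "\<lambda>_. 1"] by simp

lemma eigenfunctions_orthogonal:
  fixes f g :: "'a \<Rightarrow> 'b::{comm_ring_1,ring_char_0,ring_no_zero_divisors}"
  assumes "pair_graph H" "eigenfunction H k f" "eigenfunction H l g" "k \<noteq> l"
  shows "(\<Sum>u\<in>pverts H. f u * g u) = 0"
proof -
  have "k * (\<Sum>u\<in>pverts H. f u * g u) = (\<Sum>u\<in>pverts H. laplacian H f u * g u)"
    using assms(2) by (simp add: sum_distrib_left eigenfunction_def mult.assoc)
  also have "\<dots> = (\<Sum>u\<in>pverts H. f u * laplacian H g u)"
    by (rule laplacian_self_adjoint[OF assms(1)])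
  also have "\<dots> = l * (\<Sum>u\<in>pverts H. f u * g u)"
    using assms(3) by (simp add: sum_distrib_left eigenfunction_def ac_simps)
  finally show ?thesis using \<open>k \<noteq> l\<close> by simp
qed

lemma eigenfunction_const: "eigenfunction H 0 (\<lambda>_. c)"
  by (simp add: eigenfunction_def)

lemma eigenfunction_sum_zero:
  fixes f :: "'a \<Rightarrow> 'b::{comm_ring_1,ring_char_0,ring_no_zero_divisors}"
  assumes "pair_graph H" "eigenfunction H k f" "k \<noteq> 0"
  shows "(\<Sum>u\<in>pverts H. f u) = 0"
  using eigenfunctions_orthogonal[OF assms(1,2) eigenfunction_const[of H 1] assms(3)] by simp

lemma connected_iff_rtrancl:
  assumes "pair_graph H"
  shows "Digraph_Component.connected (with_proj H) \<longleftrightarrow>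
    pverts H \<noteq> {} \<and> (\<forall>u\<in>pverts H. \<forall>v\<in>pverts H. (u, v) \<in> (parcs H)\<^sup>*)"
proof -
  interpret pair_graph H by fact
  have "symcl (parcs H) = parcs H"
    using arcs_symmetric by (auto simp: symcl_def)
  then have "Digraph_Component.connected (with_proj H) = strongly_connected (with_proj H)"
    by (simp add: connected_conv strongly_connected_def reachable_def)
  then show ?thesis by (simp add: strongly_connected_def reachable_conv')
qed

lemma connected_nonempty: "Digraph_Component.connected (with_proj H) \<Longrightarrow> pverts H \<noteq> {}"
  by (auto simp: connected_def strongly_connected_def mk_symmetric_def)

text \<open>
The Dirichlet form of a harmonic function vanishes, and it is a sum of squares over the edges.
\<close>

lemma harmonic_constant_on_edges:
  fixes f :: "'a \<Rightarrow> real"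
  assumes "pair_graph H" "eigenfunction H 0 f" "(u, v) \<in> parcs H"
  shows "f u = f v"
proof -
  let ?V = "pverts H"
  let ?s = "\<lambda>u w. if (u, w) \<in> parcs H then (f u - f w) * (f u - f w) else 0"
  have fin: "finite ?V" using assms(1) by (rule pair_graph_finite)
  have "(\<Sum>u\<in>?V. \<Sum>w\<in>?V. ?s u w) = 0"
    using sum_laplacian_mult[OF assms(1), of f f] assms(2) by (simp add: eigenfunction_def)
  then have "\<forall>u\<in>?V. (\<Sum>w\<in>?V. ?s u w) = 0"
    using fin by (subst (asm) sum_nonneg_eq_0_iff) (auto intro!: sum_nonneg)
  then have "\<forall>u\<in>?V. \<forall>w\<in>?V. ?s u w = 0"
    using fin by (subst (asm) sum_nonneg_eq_0_iff) auto
  then show ?thesis using pair_graph_arcs[OF assms(1,3)] assms(3) by fastforce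
qed

lemma connected_harmonic_constant:
  fixes f :: "'a \<Rightarrow> real"
  assumes "pair_graph H" "Digraph_Component.connected (with_proj H)" "eigenfunction H 0 f"
    and "u \<in> pverts H" "v \<in> pverts H"
  shows "f u = f v"
proof -
  have "(u, v) \<in> (parcs H)\<^sup>*" using assms connected_iff_rtrancl by blast
  then show ?thesis
    by (induction rule: rtrancl_induct) (use harmonic_constant_on_edges[OF assms(1,3)] in auto)
qed

text \<open>
Every vertex other than \<open>u\<close> is adjacent to \<open>u\<close> in exactly one of the two graphs.
\<close>

lemma laplacian_complement:
  fixes f :: "'a \<Rightarrow> 'b::comm_ring_1"
  assumes "pair_graph H" "u \<in> pverts H"
  shows "laplacian (graph_complement H) f u =
    of_nat (card (pverts H)) * f u - (\<Sum>w\<in>pverts H. f w) - laplacian H f u"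
proof -
  have 1: "laplacian (graph_complement H) f u =
      (\<Sum>w\<in>pverts H. if u \<noteq> w \<and> (u, w) \<notin> parcs H then f u - f w else 0)"
    using assms(2) by (auto simp: laplacian_def graph_complement_def intro!: sum.cong)
  have "laplacian (graph_complement H) f u + laplacian H f u = (\<Sum>w\<in>pverts H. f u - f w)"
    unfolding 1 unfolding laplacian_def sum.distrib[symmetric]
    using pair_graph_arcs(3)[OF assms(1)] by (intro sum.cong) auto
  then show ?thesis by (simp add: sum_subtractf algebra_simps)
qed

lemma pverts_graph_complement [simp]: "pverts (graph_complement H) = pverts H"
  by (simp add: graph_complement_def)

lemma pair_graph_complement: "pair_graph H \<Longrightarrow> pair_graph (graph_complement H)"
  by (rule pair_graphI) (auto simp: graph_complement_def pair_graph_finite dest: pair_graph_arcs)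

lemma graph_complement_involution: "pair_graph H \<Longrightarrow> graph_complement (graph_complement H) = H"
  by (intro pair_pre_digraph.equality) (auto simp: graph_complement_def dest: pair_graph_arcs)

lemma eigenfunction_complement:
  fixes f :: "'a \<Rightarrow> 'b::comm_ring_1"
  assumes "pair_graph H" "(\<Sum>w\<in>pverts H. f w) = 0" "eigenfunction H k f"
  shows "eigenfunction (graph_complement H) (of_nat (card (pverts H)) - k) f"
  using assms by (simp add: eigenfunction_def laplacian_complement algebra_simps)

lemma complement_eigenfunction_nonzero:
  fixes f :: "'a \<Rightarrow> 'b::{comm_ring_1,ring_char_0,ring_no_zero_divisors}"
  assumes pg: "pair_graph H" and f: "eigenfunction (graph_complement H) k f" and "k \<noteq> 0"
  shows "eigenfunction H (of_nat (card (pverts H)) - k) f"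
proof -
  have "(\<Sum>u\<in>pverts H. f u) = 0"
    using eigenfunction_sum_zero[OF pair_graph_complement[OF pg] f \<open>k \<noteq> 0\<close>] by simp
  then show ?thesis
    using eigenfunction_complement[OF pair_graph_complement[OF pg] _ f]
    by (simp add: graph_complement_involution[OF pg])
qed

section \<open>Eigenfunctions and matrices\<close>

lemma bij_betw_nth_enumeration:
  "vertex_enumeration H vs \<Longrightarrow> bij_betw ((!) vs) {..<length vs} (pverts H)"
  by (auto simp: vertex_enumeration_def intro!: bij_betw_nth)

lemma enumeration_surj:
  assumes "vertex_enumeration H vs" "u \<in> pverts H"
  obtains i where "i < length vs" "vs ! i = u"
  using assms unfolding vertex_enumeration_def by (metis in_set_conv_nth)

lemma vertex_enumeration_exists:
  assumes "finite (pverts H)"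
  obtains vs where "vertex_enumeration H vs"
  using finite_distinct_list[OF assms] by (auto simp: vertex_enumeration_def)

lemma sum_enumeration:
  "vertex_enumeration H vs \<Longrightarrow> (\<Sum>j<length vs. h (vs ! j)) = (\<Sum>u\<in>pverts H. h u)"
  by (rule sum.reindex_bij_betw[OF bij_betw_nth_enumeration])

lemma laplacian_matrix_carrier: "laplacian_matrix H vs \<in> carrier_mat (length vs) (length vs)"
  unfolding laplacian_matrix_def adjacency_matrix_def by (intro minus_carrier_mat mat_carrier)

lemma laplacian_matrix_index:
  assumes "vertex_enumeration H vs" "pair_graph H" "i < length vs" "j < length vs"
  shows "laplacian_matrix H vs $$ (i, j) =
    (if i = j then (\<Sum>w\<in>pverts H. if (vs ! i, w) \<in> parcs H then 1 else 0) else 0) -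
    (if (vs ! i, vs ! j) \<in> parcs H then 1 else 0)"
proof -
  have "out_degree (with_proj H) (vs ! i) = card {w \<in> pverts H. (vs ! i, w) \<in> parcs H}"
    unfolding out_degree_def out_arcs_def with_proj_simps
    by (rule bij_betw_same_card[of snd], rule bij_betw_byWitness[of _ "\<lambda>w. (vs ! i, w)"])
      (auto dest: pair_graph_arcs[OF assms(2)])
  then show ?thesis using assms pair_graph_finite[OF assms(2)]
    by (cases "i = j")
      (simp_all add: laplacian_matrix_def degree_matrix_def adjacency_matrix_def sum.If_cases Int_def)
qed

lemma laplacian_matrix_mult_vec:
  fixes f :: "'a \<Rightarrow> 'b::{real_algebra_1,comm_ring_1}"
  assumes vs: "vertex_enumeration H vs" and "pair_graph H" and i: "i < length vs"
  shows "(map_mat of_real (laplacian_matrix H vs) *\<^sub>v vec (length vs) (\<lambda>j. f (vs ! j))) $ i =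
    laplacian H f (vs ! i)"
proof -
  let ?deg = "\<Sum>w\<in>pverts H. if (vs ! i, w) \<in> parcs H then 1 else 0 :: real"
  have "(map_mat of_real (laplacian_matrix H vs) *\<^sub>v vec (length vs) (\<lambda>j. f (vs ! j))) $ i =
    (\<Sum>j<length vs. of_real (laplacian_matrix H vs $$ (i, j)) * f (vs ! j))"
    using i laplacian_matrix_carrier[of H vs] by (simp add: scalar_prod_def atLeast0LessThan)
  also have "\<dots> = (\<Sum>j<length vs. (if i = j then of_real ?deg * f (vs ! j) else 0) -
      (if (vs ! i, vs ! j) \<in> parcs H then f (vs ! j) else 0))"
    by (intro sum.cong refl) (use assms in \<open>auto simp: laplacian_matrix_index algebra_simps\<close>)
  also have "\<dots> = of_real ?deg * f (vs ! i) - (\<Sum>w\<in>pverts H. if (vs ! i, w) \<in> parcs H then f w else 0)"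
    using i sum_enumeration[OF vs, of "\<lambda>w. if (vs ! i, w) \<in> parcs H then f w else 0"]
    by (simp add: sum_subtractf)
  also have "of_real ?deg * f (vs ! i) = (\<Sum>w\<in>pverts H. if (vs ! i, w) \<in> parcs H then f (vs ! i) else 0)"
    by (simp add: sum_distrib_right of_real_sum if_distrib cong: if_cong) (auto intro!: sum.cong)
  finally show ?thesis
    by (simp add: laplacian_def sum_subtractf[symmetric]) (auto intro!: sum.cong)
qed

text \<open>
Turns vectors indexed by an enumeration into functions on the vertices, so that matrix statements can
be moved to the enumeration-free setting.
\<close>

lemma function_of_vec:
  assumes "vertex_enumeration H vs" "v \<in> carrier_vec (length vs)"
  obtains f where "v = vec (length vs) (\<lambda>j. f (vs ! j))"
proof
  have inj: "inj_on ((!) vs) {..<length vs}"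
    using bij_betw_nth_enumeration[OF assms(1)] by (simp add: bij_betw_def)
  show "v = vec (length vs) (\<lambda>j. (\<lambda>u. v $ the_inv_into {..<length vs} ((!) vs) u) (vs ! j))"
    using assms(2) by (intro eq_vecI) (auto simp: the_inv_into_f_f[OF inj])
qed

lemma eigenfunction_iff_matrix:
  fixes f :: "'a \<Rightarrow> 'b::{real_algebra_1,comm_ring_1}"
  assumes "vertex_enumeration H vs" "pair_graph H"
  defines "v \<equiv> vec (length vs) (\<lambda>j. f (vs ! j))"
  shows "map_mat of_real (laplacian_matrix H vs) *\<^sub>v v = k \<cdot>\<^sub>v v \<longleftrightarrow> eigenfunction H k f"
proof -
  let ?L = "map_mat of_real (laplacian_matrix H vs) :: 'b mat"
  have "?L *\<^sub>v v = k \<cdot>\<^sub>v v \<longleftrightarrow> (\<forall>i<length vs. (?L *\<^sub>v v) $ i = k * f (vs ! i))"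
    using laplacian_matrix_carrier[of H vs] by (auto simp: vec_eq_iff v_def)
  also have "\<dots> \<longleftrightarrow> (\<forall>i<length vs. laplacian H f (vs ! i) = k * f (vs ! i))"
    using laplacian_matrix_mult_vec[OF assms(1,2), of _ f] unfolding v_def by metis
  also have "\<dots> \<longleftrightarrow> eigenfunction H k f"
    using assms(1) unfolding eigenfunction_def vertex_enumeration_def by (metis in_set_conv_nth)
  finally show ?thesis .
qed

lemma laplacian_integral_iff:
  assumes "pair_graph H"
  shows "laplacian_integral H \<longleftrightarrow>
    (\<forall>(f :: 'a \<Rightarrow> complex) k. eigenfunction H k f \<longrightarrow> (\<exists>u\<in>pverts H. f u \<noteq> 0) \<longrightarrow> k \<in> \<int>)"
    (is "_ \<longleftrightarrow> ?R")
proof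
  assume int: "laplacian_integral H"
  show ?R
  proof (intro allI impI)
    fix f :: "'a \<Rightarrow> complex" and k assume f: "eigenfunction H k f" and "\<exists>u\<in>pverts H. f u \<noteq> 0"
    then obtain u where u: "u \<in> pverts H" "f u \<noteq> 0" by blast
    obtain vs where vs: "vertex_enumeration H vs"
      using vertex_enumeration_exists[OF pair_graph_finite[OF assms]] by blast
    obtain i where i: "i < length vs" "vs ! i = u"
      using enumeration_surj[OF vs u(1)] by blast
    define v where "v = vec (length vs) (\<lambda>j. f (vs ! j))"
    have "v $ i \<noteq> 0" using i u by (simp add: v_def)
    then have "v \<noteq> 0\<^sub>v (length vs)" using i by auto
    then have "eigenvector (map_mat complex_of_real (laplacian_matrix H vs)) v k"
      using f eigenfunction_iff_matrix[OF vs assms, of f k] laplacian_matrix_carrier[of H vs]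
      by (simp add: eigenvector_def v_def)
    then show "k \<in> \<int>" using int vs by (auto simp: laplacian_integral_def eigenvalue_def)
  qed
next
  assume R: ?R
  show "laplacian_integral H" unfolding laplacian_integral_def
  proof (intro allI impI)
    fix vs k assume vs: "vertex_enumeration H vs"
      and "eigenvalue (map_mat complex_of_real (laplacian_matrix H vs)) k"
    then obtain v where v: "v \<in> carrier_vec (length vs)" "v \<noteq> 0\<^sub>v (length vs)"
        "map_mat complex_of_real (laplacian_matrix H vs) *\<^sub>v v = k \<cdot>\<^sub>v v"
      using laplacian_matrix_carrier[of H vs] by (auto simp: eigenvalue_def eigenvector_def)
    obtain f where f: "v = vec (length vs) (\<lambda>j. f (vs ! j))" using function_of_vec[OF vs v(1)] .
    have "eigenfunction H k f" using v(3) eigenfunction_iff_matrix[OF vs assms] f by blast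
    moreover obtain i where "i < length vs" "f (vs ! i) \<noteq> 0"
      using v(2) f by (auto simp: vec_eq_iff)
    then have "\<exists>u\<in>pverts H. f u \<noteq> 0" using vs nth_mem by (fastforce simp: vertex_enumeration_def)
    ultimately show "k \<in> \<int>" using R by blast
  qed
qed

text \<open>
The enumeration-free form of diagonalizability over \<open>{-1,0,1}\<close>: the signed eigenfunctions span the
space of all functions on the vertices, expressed by duality. The zero function counts as signed
eigenfunction for every eigenvalue, which changes nothing about the span.
\<close>

definition signed_complete :: "'a pair_pre_digraph \<Rightarrow> bool" where
  "signed_complete H \<longleftrightarrow>
    (\<forall>g. (\<forall>f k. signed_eigenfunction H k f \<longrightarrow> (\<Sum>u\<in>pverts H. f u * g u) = 0) \<longrightarrow>
      (\<forall>u\<in>pverts H. g u = 0))"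

lemma signed_completeD:
  assumes "signed_complete H"
    and "\<And>f k. signed_eigenfunction H k f \<Longrightarrow> (\<Sum>u\<in>pverts H. f u * g u) = 0" and "u \<in> pverts H"
  shows "g u = 0"
  using assms(1)[unfolded signed_complete_def, THEN spec, of g] assms(2,3) by blast

lemma map_mat_id [simp]: "map_mat id A = A"
  by (intro eq_matI) auto

text \<open>
The columns of a diagonalizing matrix are signed eigenfunctions, and a vector orthogonal to all columns
of an invertible matrix is zero. Conversely the finitely many signed eigenvectors separate, so \<open>n\<close> of
them form the columns of an invertible matrix.
\<close>

lemma signed_diagonalizable_iff:
  assumes "pair_graph H"
  shows "signed_diagonalizable H \<longleftrightarrow> signed_complete H"
proof
  assume diag: "signed_diagonalizable H"
  obtain vs where vs: "vertex_enumeration H vs"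
    using vertex_enumeration_exists[OF pair_graph_finite[OF assms]] by blast
  let ?L = "laplacian_matrix H vs" and ?n = "length vs"
  note L = laplacian_matrix_carrier[of H vs]
  obtain P Q D where wit: "similar_mat_wit ?L D P Q" and D: "diagonal_mat D"
    and P: "elements_mat P \<subseteq> {-1, 0, 1}"
    using diag vs by (auto simp: signed_diagonalizable_def)
  note w = similar_mat_witD2[OF L wit]
  have LP: "?L * P = P * D"
  proof -
    have "?L * P = P * D * Q * P" using w(3) by simp
    also have "\<dots> = P * D * (Q * P)"
      by (rule assoc_mult_mat[OF mult_carrier_mat[OF w(6,5)] w(7,6)])
    also have "\<dots> = P * D" using w(2) right_mult_one_mat[OF mult_carrier_mat[OF w(6,5)]] by simp
    finally show ?thesis .
  qed
  show "signed_complete H" unfolding signed_complete_def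
  proof (intro allI impI)
    fix g :: "'a \<Rightarrow> real"
    assume orth: "\<forall>f k. signed_eigenfunction H k f \<longrightarrow> (\<Sum>u\<in>pverts H. f u * g u) = 0"
    define y where "y = vec ?n (\<lambda>j. g (vs ! j))"
    have y: "y \<in> carrier_vec ?n" by (simp add: y_def)
    have "P\<^sup>T *\<^sub>v y = 0\<^sub>v ?n"
    proof (intro eq_vecI)
      fix j assume "j < dim_vec (0\<^sub>v ?n)"
      then have j: "j < ?n" by simp
      have "col P j \<in> carrier_vec ?n" using col_carrier_vec[OF j w(6)] .
      then obtain f where f: "col P j = vec ?n (\<lambda>i. f (vs ! i))" using function_of_vec[OF vs] by blast
      have "?L *\<^sub>v col P j = col (P * D) j" using LP w j by (metis col_mult2)
      also have "\<dots> = D $$ (j, j) \<cdot>\<^sub>v col P j"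
      proof (intro eq_vecI)
        fix i assume "i < dim_vec (D $$ (j, j) \<cdot>\<^sub>v col P j)"
        then have i: "i < ?n" using w(6) by simp
        have "(\<Sum>k<?n. P $$ (i, k) * D $$ (k, j)) = (\<Sum>k\<in>{j}. P $$ (i, k) * D $$ (k, j))"
          using j D w(5) by (intro sum.mono_neutral_right) (auto simp: diagonal_mat_def)
        then show "col (P * D) j $ i = (D $$ (j, j) \<cdot>\<^sub>v col P j) $ i"
          using i j w(5,6) by (simp add: scalar_prod_def atLeast0LessThan)
      qed (use w(5,6) in auto)
      finally have "eigenfunction H (D $$ (j, j)) f"
        using eigenfunction_iff_matrix[OF vs assms, of f "D $$ (j, j)"] f by simp
      moreover have "f u \<in> {-1,0,1}" if u: "u \<in> pverts H" for u
      proof -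
        obtain i where i: "i < ?n" "vs ! i = u"
          using enumeration_surj[OF vs u] by blast
        then have "f u = col P j $ i" using f by simp
        then have "f u = P $$ (i, j)" using i j w(6) by simp
        moreover have "P $$ (i, j) \<in> elements_mat P" using i j w(6) by (intro elements_matI) auto
        ultimately show ?thesis using P by auto
      qed
      ultimately have "(\<Sum>u\<in>pverts H. f u * g u) = 0"
        using orth by (auto simp: signed_eigenfunction_def)
      then have "col P j \<bullet> y = 0"
        using sum_enumeration[OF vs, of "\<lambda>u. f u * g u"]
        by (simp add: f y_def scalar_prod_def atLeast0LessThan)
      then show "(P\<^sup>T *\<^sub>v y) $ j = 0\<^sub>v ?n $ j" using w(6) j by simp
    qed (use w(6) in auto)
    then have "Q\<^sup>T *\<^sub>v (P\<^sup>T *\<^sub>v y) = 0\<^sub>v ?n" using w(7) by (intro eq_vecI) auto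
    moreover have "Q\<^sup>T *\<^sub>v (P\<^sup>T *\<^sub>v y) = (Q\<^sup>T * P\<^sup>T) *\<^sub>v y"
      using w(6,7) y by (intro assoc_mult_mat_vec[symmetric]) auto
    moreover have "Q\<^sup>T * P\<^sup>T = 1\<^sub>m ?n" using transpose_mult[OF w(6,7)] w(1) by simp
    ultimately have "y = 0\<^sub>v ?n" using y by simp
    then have "\<forall>j<?n. g (vs ! j) = 0" by (simp add: y_def vec_eq_iff)
    then show "\<forall>u\<in>pverts H. g u = 0"
      using enumeration_surj[OF vs] by metis
  qed
next
  assume complete: "signed_complete H"
  show "signed_diagonalizable H" unfolding signed_diagonalizable_def
  proof (intro allI impI)
    fix vs assume vs: "vertex_enumeration H vs"
    let ?L = "laplacian_matrix H vs" and ?n = "length vs"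
    note L = laplacian_matrix_carrier[of H vs]
    define S where "S = {v \<in> carrier_vec ?n. (\<forall>i<?n. v $ i \<in> {-1,0,1}) \<and> (\<exists>k. ?L *\<^sub>v v = k \<cdot>\<^sub>v v)}"
    have "finite S" unfolding S_def
      by (rule finite_subset[OF _ finite_vectors_over[of "{-1,0,1::real}" ?n]]) auto
    have "separating ?n S" unfolding separating_def
    proof (intro ballI impI)
      fix y :: "real vec" assume y: "y \<in> carrier_vec ?n" and orth: "\<forall>s\<in>S. s \<bullet> y = 0"
      obtain g where g: "y = vec ?n (\<lambda>i. g (vs ! i))" using function_of_vec[OF vs y] .
      have "(\<Sum>u\<in>pverts H. f u * g u) = 0" if f: "signed_eigenfunction H k f" for f k
      proof -
        have "vec ?n (\<lambda>i. f (vs ! i)) \<in> S"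
          using f eigenfunction_iff_matrix[OF vs assms, of f k] vs
          by (auto simp: S_def signed_eigenfunction_def vertex_enumeration_def)
        then have "vec ?n (\<lambda>i. f (vs ! i)) \<bullet> y = 0" using orth by blast
        then show ?thesis using sum_enumeration[OF vs, of "\<lambda>u. f u * g u"]
          by (simp add: g scalar_prod_def atLeast0LessThan)
      qed
      then have "\<forall>u\<in>pverts H. g u = 0" using complete unfolding signed_complete_def by blast
      then show "y = 0\<^sub>v ?n" using vs nth_mem by (auto simp: g vec_eq_iff vertex_enumeration_def)
    qed
    then obtain B where B: "B \<subseteq> S" "separating ?n B" "card B = ?n"
      using separating_contains_basis[of S ?n] \<open>finite S\<close> by (auto simp: S_def)
    obtain bs where bs: "set bs = B" "distinct bs"
      using B(1) \<open>finite S\<close> finite_distinct_list finite_subset by metis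
    have len: "length bs = ?n" using bs B(3) distinct_card by metis
    have carrier: "set bs \<subseteq> carrier_vec ?n" using bs B(1) by (auto simp: S_def)
    define P where "P = mat_of_cols ?n bs"
    obtain Q where Q: "Q \<in> carrier_mat ?n ?n" "P * Q = 1\<^sub>m ?n" "Q * P = 1\<^sub>m ?n"
      using separating_columns_invertible[OF carrier len] B(2) bs unfolding P_def by metis
    have P: "P \<in> carrier_mat ?n ?n" unfolding P_def by (intro carrier_matI) (simp_all only: len mat_of_rows_carrier mat_of_cols_carrier)
    have bsS: "bs ! j \<in> S" if "j < ?n" for j using that bs(1) B(1) len by (metis nth_mem subsetD)
    then have bsC: "bs ! j \<in> carrier_vec ?n" if "j < ?n" for j using that by (auto simp: S_def)
    have "\<exists>k. ?L *\<^sub>v (bs ! j) = k \<cdot>\<^sub>v (bs ! j)" if "j < ?n" for j using bsS[OF that] by (auto simp: S_def)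
    then obtain ev where ev: "?L *\<^sub>v (bs ! j) = ev j \<cdot>\<^sub>v (bs ! j)" if "j < ?n" for j by metis
    define D where "D = mat ?n ?n (\<lambda>(i, j). if i = j then ev j else 0)"
    have D: "D \<in> carrier_mat ?n ?n" "diagonal_mat D" by (auto simp: D_def diagonal_mat_def)
    have "?L * P = P * D"
    proof (intro eq_matI)
      fix i j assume "i < dim_row (P * D)" "j < dim_col (P * D)"
      then have ij: "i < ?n" "j < ?n" using P D by auto
      have colP: "col P j = bs ! j" unfolding P_def using ij len bsC by (intro col_mat_of_cols) auto
      have "(?L * P) $$ (i, j) = (?L *\<^sub>v (bs ! j)) $ i" using ij L P colP by simp
      also have "\<dots> = ev j * bs ! j $ i"
        using ev[OF ij(2)] ij(1) carrier_vecD[OF bsC[OF ij(2)]] by (metis index_smult_vec(1))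
      also have "\<dots> = (\<Sum>k\<in>{j}. P $$ (i, k) * D $$ (k, j))"
        using ij by (simp add: D_def P_def mat_of_cols_index len)
      also have "\<dots> = (\<Sum>k<?n. P $$ (i, k) * D $$ (k, j))"
        using ij by (intro sum.mono_neutral_left) (auto simp: D_def)
      also have "\<dots> = (P * D) $$ (i, j)" using ij P D by (simp add: scalar_prod_def atLeast0LessThan)
      finally show "(?L * P) $$ (i, j) = (P * D) $$ (i, j)" .
    qed (use L P D in auto)
    then have "?L = P * D * Q"
      using Q L P by (metis assoc_mult_mat right_mult_one_mat)
    then have "similar_mat_wit ?L D P Q"
      using Q L P D by (intro similar_mat_witI) auto
    moreover have "elements_mat P \<subseteq> {-1,0,1}"
    proof
      fix x assume "x \<in> elements_mat P"
      then obtain i j where "i < ?n" "j < ?n" "x = P $$ (i, j)" using P by auto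
      then show "x \<in> {-1,0,1}" using bsS[of j] by (auto simp: P_def mat_of_cols_index len S_def)
    qed
    ultimately show "\<exists>P Q D. similar_mat_wit ?L D P Q \<and> diagonal_mat D \<and> elements_mat P \<subseteq> {-1, 0, 1}"
      using D(2) by blast
  qed
qed

text \<open>
An eigenfunction is nonzero, so it fails to be orthogonal to some signed eigenfunction and has the
same eigenvalue as that one. At a vertex where the latter is \<open>\<plusminus>1\<close>, the eigenvalue is up to sign a
value of the Laplacian of an integer-valued function.
\<close>

lemma signed_complete_imp_integral:
  assumes pg: "pair_graph H" and complete: "signed_complete H"
  shows "laplacian_integral H"
  unfolding laplacian_integral_iff[OF pg]
proof (intro allI impI)
  fix f :: "'a \<Rightarrow> complex" and k
  assume f: "eigenfunction H k f" and nz: "\<exists>u\<in>pverts H. f u \<noteq> 0"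
  have "\<exists>e l. signed_eigenfunction H l e \<and> (\<Sum>u\<in>pverts H. complex_of_real (e u) * f u) \<noteq> 0"
  proof (rule ccontr)
    assume "\<not> ?thesis"
    then have orth: "(\<Sum>u\<in>pverts H. complex_of_real (e u) * f u) = 0"
      if "signed_eigenfunction H l e" for e l using that by blast
    have "(\<Sum>u\<in>pverts H. e u * Re (f u)) = 0" "(\<Sum>u\<in>pverts H. e u * Im (f u)) = 0"
      if "signed_eigenfunction H l e" for e l
      using arg_cong[OF orth[OF that], of Re] arg_cong[OF orth[OF that], of Im] by simp_all
    then have "\<forall>u\<in>pverts H. Re (f u) = 0" "\<forall>u\<in>pverts H. Im (f u) = 0"
      using signed_completeD[OF complete, of "\<lambda>u. Re (f u)"] signed_completeD[OF complete, of "\<lambda>u. Im (f u)"]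
      by blast+
    then show False using nz complex_eq_iff by auto
  qed
  then obtain e l where e: "signed_eigenfunction H l e"
    and ef: "(\<Sum>u\<in>pverts H. complex_of_real (e u) * f u) \<noteq> 0" by blast
  have "eigenfunction H (complex_of_real l) (\<lambda>u. complex_of_real (e u))"
    unfolding eigenfunction_def
  proof
    fix u assume u: "u \<in> pverts H"
    have "laplacian H (\<lambda>u. complex_of_real (e u)) u = complex_of_real (laplacian H e u)"
      unfolding laplacian_def of_real_sum by (intro sum.cong refl) simp
    then show "laplacian H (\<lambda>u. complex_of_real (e u)) u = complex_of_real l * complex_of_real (e u)"
      using e u by (simp add: signed_eigenfunction_def eigenfunction_def)
  qed
  then have "k = complex_of_real l" using eigenfunctions_orthogonal[OF pg _ f] ef by blast
  moreover have "l \<in> \<int>"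
  proof -
    obtain u where u: "u \<in> pverts H" "e u \<noteq> 0"
    proof (rule ccontr)
      assume "\<not> thesis"
      then have "\<forall>u\<in>pverts H. e u = 0" using that by blast
      then show False using ef by simp
    qed
    have entry: "e w \<in> \<int>" if "w \<in> pverts H" for w
      using e that by (force simp: signed_eigenfunction_def)
    then have "laplacian H e u \<in> \<int>"
      unfolding laplacian_def using u(1) by (intro Ints_sum) auto
    then have int: "l * e u \<in> \<int>" using e u(1) by (simp add: signed_eigenfunction_def eigenfunction_def)
    have "e u = 1 \<or> e u = -1" using e u by (auto simp: signed_eigenfunction_def)
    then show ?thesis
      using int by (auto simp: minus_in_Ints_iff)
  qed
  ultimately show "k \<in> \<int>" by (auto elim!: Ints_cases)
qed

section \<open>Disjoint unions and complements\<close>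

lemma pverts_disjoint_union:
  "pverts (disjoint_union Gs) = (SIGMA i:{..<length Gs}. pverts (Gs ! i))"
  by (auto simp: disjoint_union_def)

lemma arcs_disjoint_union:
  "((i, u), (j, v)) \<in> parcs (disjoint_union Gs) \<longleftrightarrow> i < length Gs \<and> j = i \<and> (u, v) \<in> parcs (Gs ! i)"
  by (simp add: disjoint_union_def)

lemma pair_graph_disjoint_union:
  assumes "\<forall>H\<in>set Gs. pair_graph H"
  shows "pair_graph (disjoint_union Gs)"
proof (rule pair_graphI)
  have pg: "pair_graph (Gs ! i)" if "i < length Gs" for i by (rule bspec[OF assms nth_mem[OF that]])
  show "finite (pverts (disjoint_union Gs))"
    unfolding pverts_disjoint_union by (rule finite_SigmaI) (simp_all add: pair_graph_finite[OF pg])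
  fix p q assume "(p, q) \<in> parcs (disjoint_union Gs)"
  then obtain i u v where pq: "p = (i, u)" "q = (i, v)" "i < length Gs" "(u, v) \<in> parcs (Gs ! i)"
    by (cases p; cases q) (auto simp: arcs_disjoint_union)
  then show "p \<in> pverts (disjoint_union Gs) \<and> q \<in> pverts (disjoint_union Gs) \<and> p \<noteq> q \<and>
      (q, p) \<in> parcs (disjoint_union Gs)"
    using pair_graph_arcs[OF pg[OF pq(3)] pq(4)]
    by (simp add: arcs_disjoint_union pverts_disjoint_union)
qed

lemma sum_disjoint_union:
  assumes "\<forall>H\<in>set Gs. pair_graph H"
  shows "(\<Sum>p\<in>pverts (disjoint_union Gs). F p) = (\<Sum>i<length Gs. \<Sum>w\<in>pverts (Gs ! i). F (i, w))"
proof -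
  have "\<forall>i\<in>{..<length Gs}. finite (pverts (Gs ! i))"
    using pair_graph_finite[OF bspec[OF assms nth_mem]] by simp
  then show ?thesis unfolding pverts_disjoint_union by (subst sum.Sigma) simp_all
qed

lemma laplacian_disjoint_union:
  assumes "\<forall>H\<in>set Gs. pair_graph H" and i: "i < length Gs"
  shows "laplacian (disjoint_union Gs) F (i, u) = laplacian (Gs ! i) (\<lambda>w. F (i, w)) u"
proof -
  have "laplacian (disjoint_union Gs) F (i, u) = (\<Sum>j<length Gs. \<Sum>w\<in>pverts (Gs ! j).
      if j = i \<and> (u, w) \<in> parcs (Gs ! i) then F (i, u) - F (j, w) else 0)"
    unfolding laplacian_def sum_disjoint_union[OF assms(1)]
    using i by (intro sum.cong refl if_cong) (auto simp: arcs_disjoint_union)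
  also have "\<dots> = (\<Sum>j<length Gs. if j = i then laplacian (Gs ! i) (\<lambda>w. F (i, w)) u else 0)"
    by (intro sum.cong refl) (auto simp: laplacian_def)
  finally show ?thesis using i by simp
qed

lemma eigenfunction_disjoint_union:
  assumes "\<forall>H\<in>set Gs. pair_graph H"
  shows "eigenfunction (disjoint_union Gs) k F \<longleftrightarrow>
    (\<forall>i<length Gs. eigenfunction (Gs ! i) k (\<lambda>w. F (i, w)))"
  using laplacian_disjoint_union[OF assms, of _ F]
  by (auto simp: eigenfunction_def pverts_disjoint_union)

lemma eigenfunction_extend:
  assumes "\<forall>H\<in>set Gs. pair_graph H" and "i < length Gs" "eigenfunction (Gs ! i) k f"
  shows "eigenfunction (disjoint_union Gs) k (\<lambda>(j, w). if j = i then f w else 0)"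
proof -
  have "eigenfunction (Gs ! j) k (\<lambda>w. if j = i then f w else 0)" for j
    using assms(3) by (cases "j = i") (simp_all add: eigenfunction_def)
  then show ?thesis by (simp add: eigenfunction_disjoint_union[OF assms(1)])
qed

lemma sum_extend:
  assumes "\<forall>H\<in>set Gs. pair_graph H" and "i < length Gs"
  shows "(\<Sum>p\<in>pverts (disjoint_union Gs). (case p of (j, w) \<Rightarrow> if j = i then h w else 0) * F p) =
    (\<Sum>w\<in>pverts (Gs ! i). h w * (F (i, w) :: 'b::comm_ring_1))"
proof -
  have "(\<Sum>p\<in>pverts (disjoint_union Gs). (case p of (j, w) \<Rightarrow> if j = i then h w else 0) * F p) =
      (\<Sum>j<length Gs. if j = i then (\<Sum>w\<in>pverts (Gs ! i). h w * F (i, w)) else 0)"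
    unfolding sum_disjoint_union[OF assms(1)] by (intro sum.cong refl) auto
  then show ?thesis using assms(2) by simp
qed

lemma laplacian_integral_disjoint_union:
  assumes pg: "\<forall>H\<in>set Gs. pair_graph H"
  shows "laplacian_integral (disjoint_union Gs) \<longleftrightarrow> (\<forall>H\<in>set Gs. laplacian_integral H)"
proof
  assume int: "laplacian_integral (disjoint_union Gs)"
  show "\<forall>H\<in>set Gs. laplacian_integral H"
  proof
    fix H assume "H \<in> set Gs"
    then obtain i where i: "i < length Gs" "H = Gs ! i" by (metis in_set_conv_nth)
    show "laplacian_integral H" unfolding laplacian_integral_iff[OF bspec[OF pg \<open>H \<in> set Gs\<close>]]
    proof (intro allI impI)
      fix f :: "'a \<Rightarrow> complex" and k assume f: "eigenfunction H k f" "\<exists>u\<in>pverts H. f u \<noteq> 0"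
      then obtain u where "u \<in> pverts H" "f u \<noteq> 0" by blast
      then have "\<exists>p\<in>pverts (disjoint_union Gs). (\<lambda>(j, w). if j = i then f w else 0) p \<noteq> 0"
        using i by (intro bexI[of _ "(i, u)"]) (auto simp: pverts_disjoint_union)
      moreover have "eigenfunction (disjoint_union Gs) k (\<lambda>(j, w). if j = i then f w else 0)"
        using eigenfunction_extend[OF pg] f(1) i by blast
      ultimately show "k \<in> \<int>"
        using int laplacian_integral_iff[OF pair_graph_disjoint_union[OF pg]] by blast
    qed
  qed
next
  assume int: "\<forall>H\<in>set Gs. laplacian_integral H"
  show "laplacian_integral (disjoint_union Gs)"
    unfolding laplacian_integral_iff[OF pair_graph_disjoint_union[OF pg]]
  proof (intro allI impI)
    fix F :: "nat \<times> 'a \<Rightarrow> complex" and k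
    assume F: "eigenfunction (disjoint_union Gs) k F" "\<exists>p\<in>pverts (disjoint_union Gs). F p \<noteq> 0"
    then obtain i u where iu: "i < length Gs" "u \<in> pverts (Gs ! i)" "F (i, u) \<noteq> 0"
      by (auto simp: pverts_disjoint_union)
    have "eigenfunction (Gs ! i) k (\<lambda>w. F (i, w))"
      using F(1) iu(1) eigenfunction_disjoint_union[OF pg] by blast
    moreover have "Gs ! i \<in> set Gs" using iu(1) by simp
    ultimately show "k \<in> \<int>"
      using int iu laplacian_integral_iff[OF bspec[OF pg]] by blast
  qed
qed

lemma laplacian_integral_complement:
  assumes pg: "pair_graph H" and int: "laplacian_integral H"
  shows "laplacian_integral (graph_complement H)"
  unfolding laplacian_integral_iff[OF pair_graph_complement[OF pg]]
proof (intro allI impI)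
  fix f :: "'a \<Rightarrow> complex" and k
  assume f: "eigenfunction (graph_complement H) k f" "\<exists>u\<in>pverts (graph_complement H). f u \<noteq> 0"
  show "k \<in> \<int>"
  proof (cases "k = 0")
    case False
    then have "eigenfunction H (of_nat (card (pverts H)) - k) f"
      by (rule complement_eigenfunction_nonzero[OF pg f(1)])
    then have "of_nat (card (pverts H)) - k \<in> \<int>"
      using int f(2) laplacian_integral_iff[OF pg] by auto
    then have "of_nat (card (pverts H)) - (of_nat (card (pverts H)) - k) \<in> \<int>"
      using Ints_diff Ints_of_nat by blast
    then show ?thesis by simp
  qed simp
qed

text \<open>
Vertices of different parts are adjacent in the complement, and two vertices of the same part have a
common neighbour in another part.
\<close>

lemma complement_disjoint_union_harmonic:
  fixes F :: "nat \<times> 'a \<Rightarrow> real"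
  assumes pg: "\<forall>H\<in>set Gs. pair_graph H" and ne: "\<forall>H\<in>set Gs. pverts H \<noteq> {}"
    and len: "length Gs \<ge> 2" and F: "eigenfunction (graph_complement (disjoint_union Gs)) 0 F"
    and pq: "p \<in> pverts (disjoint_union Gs)" "q \<in> pverts (disjoint_union Gs)"
  shows "F p = F q"
proof -
  let ?U = "disjoint_union Gs"
  have different: "F p = F q"
    if "p \<in> pverts ?U" "q \<in> pverts ?U" "fst p \<noteq> fst q" for p q
  proof (rule harmonic_constant_on_edges[OF pair_graph_complement[OF pair_graph_disjoint_union[OF pg]] F])
    show "(p, q) \<in> parcs (graph_complement ?U)"
      using that by (cases p; cases q) (auto simp: graph_complement_def arcs_disjoint_union)
  qed
  show ?thesis
  proof (cases "fst p = fst q")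
    case True
    \<comment> \<open>The index of a part other than that of p and q.\<close>
    define k where "k = (if fst p = 0 then 1 else 0 :: nat)"
    have k: "k < length Gs" "k \<noteq> fst p" using len by (auto simp: k_def)
    then obtain c where "c \<in> pverts (Gs ! k)" using bspec[OF ne nth_mem] by blast
    then have c: "(k, c) \<in> pverts ?U" using k by (simp add: pverts_disjoint_union)
    have "F p = F (k, c)" using different[OF pq(1) c] k(2) by simp
    moreover have "F q = F (k, c)" using different[OF pq(2) c] k(2) True by simp
    ultimately show ?thesis by simp
  qed (rule different[OF pq])
qed

section \<open>Isomorphism invariance\<close>

text \<open>
Isomorphism of graphs without parallel edges as a map on vertices alone; the arc map of
\<^const>\<open>digraph_iso\<close> is determined by it.
\<close>

definition graph_bijection :: "('a \<Rightarrow> 'b) \<Rightarrow> 'a pair_pre_digraph \<Rightarrow> 'b pair_pre_digraph \<Rightarrow> bool" where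
  "graph_bijection \<phi> G H \<longleftrightarrow> bij_betw \<phi> (pverts G) (pverts H) \<and>
    (\<forall>u\<in>pverts G. \<forall>v\<in>pverts G. (u, v) \<in> parcs G \<longleftrightarrow> (\<phi> u, \<phi> v) \<in> parcs H)"

lemma digraph_iso_iff_bijection:
  assumes "pair_graph G" "pair_graph H"
  shows "digraph_iso (with_proj G) (with_proj H) \<longleftrightarrow> (\<exists>\<phi>. graph_bijection \<phi> G H)"
proof
  assume "digraph_iso (with_proj G) (with_proj H)"
  then obtain h where iso: "pre_digraph.digraph_isomorphism (with_proj G) h"
    and H: "with_proj H = app_iso h (with_proj G)"
    by (auto simp: digraph_iso_def)
  let ?\<phi> = "iso_verts h"
  have verts: "pverts H = ?\<phi> ` pverts G" using H by (metis verts_app_iso with_proj_simps(1))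
  have arcs: "parcs H = iso_arcs h ` parcs G" using H by (metis arcs_app_iso with_proj_simps(2))
  have "iso_tail h = fst" using H by (metis tail_app_iso with_proj_simps(4))
  moreover have "iso_head h = snd" using H by (metis head_app_iso with_proj_simps(5))
  ultimately have arc: "iso_arcs h (u, v) = (?\<phi> u, ?\<phi> v)" if "(u, v) \<in> parcs G" for u v
    using iso that by (auto simp: pre_digraph.digraph_isomorphism_def prod_eq_iff)
  have inj: "inj_on ?\<phi> (pverts G)"
    using iso by (simp add: pre_digraph.digraph_isomorphism_def)
  have "(u, v) \<in> parcs G \<longleftrightarrow> (?\<phi> u, ?\<phi> v) \<in> parcs H" if uv: "u \<in> pverts G" "v \<in> pverts G" for u v
  proof
    assume "(u, v) \<in> parcs G"
    then show "(?\<phi> u, ?\<phi> v) \<in> parcs H" using arc arcs by (metis image_eqI)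
  next
    assume "(?\<phi> u, ?\<phi> v) \<in> parcs H"
    then obtain a b where ab: "(a, b) \<in> parcs G" "(?\<phi> u, ?\<phi> v) = iso_arcs h (a, b)" using arcs by auto
    then have "?\<phi> u = ?\<phi> a" "?\<phi> v = ?\<phi> b" using arc by auto
    then show "(u, v) \<in> parcs G"
      using uv ab(1) inj pair_graph_arcs[OF assms(1) ab(1)] by (metis inj_onD)
  qed
  then show "\<exists>\<phi>. graph_bijection \<phi> G H"
    using inj verts by (auto simp: graph_bijection_def bij_betw_def)
next
  assume "\<exists>\<phi>. graph_bijection \<phi> G H"
  then obtain \<phi> where \<phi>: "graph_bijection \<phi> G H" by blast
  interpret G: pair_graph G by fact
  interpret H: pair_graph H by fact
  let ?h = "\<lparr>iso_verts = \<phi>, iso_arcs = map_prod \<phi> \<phi>, iso_head = snd, iso_tail = fst\<rparr>"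
  have inj: "inj_on \<phi> (pverts G)" and img: "\<phi> ` pverts G = pverts H"
    using \<phi> by (auto simp: graph_bijection_def bij_betw_def)
  have "parcs G \<subseteq> pverts G \<times> pverts G" using pair_graph_arcs[OF assms(1)] by auto
  then have "inj_on (map_prod \<phi> \<phi>) (parcs G)"
    using map_prod_inj_on[OF inj inj] inj_on_subset by blast
  then have "pre_digraph.digraph_isomorphism (with_proj G) ?h"
    using inj G.wf_digraph_axioms by (simp add: pre_digraph.digraph_isomorphism_def)
  moreover have "map_prod \<phi> \<phi> ` parcs G = parcs H"
  proof (intro equalityI subsetI)
    fix x assume "x \<in> map_prod \<phi> \<phi> ` parcs G"
    then obtain u v where uv: "(u, v) \<in> parcs G" "x = (\<phi> u, \<phi> v)" by auto
    then show "x \<in> parcs H"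
      using \<phi> pair_graph_arcs(1,2)[OF assms(1) uv(1)] by (simp add: graph_bijection_def)
  next
    fix x assume x: "x \<in> parcs H"
    then obtain a b where ab: "x = (a, b)" by (cases x)
    then have "a \<in> \<phi> ` pverts G" "b \<in> \<phi> ` pverts G"
      using x img pair_graph_arcs(1,2)[OF assms(2), of a b] by auto
    then obtain u v where "u \<in> pverts G" "v \<in> pverts G" "a = \<phi> u" "b = \<phi> v" by blast
    then show "x \<in> map_prod \<phi> \<phi> ` parcs G"
      using \<phi> x ab by (intro rev_image_eqI[of "(u, v)"]) (auto simp: graph_bijection_def)
  qed
  then have "with_proj H = app_iso ?h (with_proj G)"
    using img by (simp add: app_iso_def with_proj_def)
  ultimately show "digraph_iso (with_proj G) (with_proj H)"
    unfolding digraph_iso_def by blast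
qed

lemma graph_bijection_inverse:
  assumes "graph_bijection \<phi> G H"
  shows "graph_bijection (the_inv_into (pverts G) \<phi>) H G"
proof -
  let ?\<psi> = "the_inv_into (pverts G) \<phi>"
  have bij: "bij_betw \<phi> (pverts G) (pverts H)" using assms by (simp add: graph_bijection_def)
  have "bij_betw ?\<psi> (pverts H) (pverts G)" by (rule bij_betw_the_inv_into[OF bij])
  moreover have "(a, b) \<in> parcs H \<longleftrightarrow> (?\<psi> a, ?\<psi> b) \<in> parcs G" if "a \<in> pverts H" "b \<in> pverts H" for a b
  proof -
    have "\<phi> (?\<psi> a) = a" "\<phi> (?\<psi> b) = b"
      using f_the_inv_into_f_bij_betw[OF bij] that by simp_all
    moreover have "?\<psi> a \<in> pverts G" "?\<psi> b \<in> pverts G"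
      using bij_betwE[OF bij_betw_the_inv_into[OF bij]] that by simp_all
    ultimately show ?thesis using assms by (simp add: graph_bijection_def)
  qed
  ultimately show ?thesis by (simp add: graph_bijection_def)
qed

lemma graph_bijection_complement:
  "graph_bijection \<phi> G H \<Longrightarrow> graph_bijection \<phi> (graph_complement G) (graph_complement H)"
  by (auto simp: graph_bijection_def graph_complement_def bij_betw_def inj_on_def)

lemma graph_bijection_sum:
  "graph_bijection \<phi> G H \<Longrightarrow> (\<Sum>u\<in>pverts G. h (\<phi> u)) = (\<Sum>v\<in>pverts H. h v)"
  by (rule sum.reindex_bij_betw) (simp add: graph_bijection_def)

lemma graph_bijection_eigenfunction:
  assumes "graph_bijection \<phi> G H" "eigenfunction H k f"
  shows "eigenfunction G k (\<lambda>u. f (\<phi> u))"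
  unfolding eigenfunction_def
proof
  fix u assume u: "u \<in> pverts G"
  have "laplacian G (\<lambda>u. f (\<phi> u)) u =
      (\<Sum>w\<in>pverts G. if (\<phi> u, \<phi> w) \<in> parcs H then f (\<phi> u) - f (\<phi> w) else 0)"
    unfolding laplacian_def using assms(1) u
    by (intro sum.cong refl if_cong) (auto simp: graph_bijection_def)
  also have "\<dots> = laplacian H f (\<phi> u)"
    unfolding laplacian_def
    by (rule graph_bijection_sum[OF assms(1), where h = "\<lambda>v. if (\<phi> u, v) \<in> parcs H then f (\<phi> u) - f v else 0"])
  also have "\<phi> u \<in> pverts H" using assms(1) u by (auto simp: graph_bijection_def bij_betw_def)
  then have "laplacian H f (\<phi> u) = k * f (\<phi> u)" using assms(2) by (rule eigenfunctionD[rotated])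
  finally show "laplacian G (\<lambda>u. f (\<phi> u)) u = k * f (\<phi> u)" .
qed

lemma laplacian_integral_bijection:
  assumes "pair_graph G" "pair_graph H" "graph_bijection \<phi> G H" "laplacian_integral G"
  shows "laplacian_integral H"
  unfolding laplacian_integral_iff[OF assms(2)]
proof (intro allI impI)
  fix f :: "'b \<Rightarrow> complex" and k assume f: "eigenfunction H k f" "\<exists>u\<in>pverts H. f u \<noteq> 0"
  have "\<phi> ` pverts G = pverts H" using assms(3) by (simp add: graph_bijection_def bij_betw_def)
  then have "\<exists>u\<in>pverts G. f (\<phi> u) \<noteq> 0" using f(2) by (metis imageE)
  then show "k \<in> \<int>"
    using assms(4) graph_bijection_eigenfunction[OF assms(3) f(1)]
    unfolding laplacian_integral_iff[OF assms(1)] by blast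
qed

lemma signed_complete_bijection:
  assumes "graph_bijection \<phi> G H" "signed_complete G"
  shows "signed_complete H"
  unfolding signed_complete_def
proof (intro allI impI)
  fix g :: "'b \<Rightarrow> real"
  assume orth: "\<forall>f k. signed_eigenfunction H k f \<longrightarrow> (\<Sum>u\<in>pverts H. f u * g u) = 0"
  let ?\<psi> = "the_inv_into (pverts G) \<phi>"
  have bij: "bij_betw \<phi> (pverts G) (pverts H)" using assms(1) by (simp add: graph_bijection_def)
  have inv: "graph_bijection ?\<psi> H G" by (rule graph_bijection_inverse[OF assms(1)])
  have "(\<Sum>u\<in>pverts G. f u * g (\<phi> u)) = 0" if f: "signed_eigenfunction G k f" for f k
  proof -
    have "\<forall>a\<in>pverts H. ?\<psi> a \<in> pverts G" using inv bij_betwE by (auto simp: graph_bijection_def)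
    then have "signed_eigenfunction H k (\<lambda>a. f (?\<psi> a))"
      using f graph_bijection_eigenfunction[OF inv, of k f]
      by (auto simp: signed_eigenfunction_def)
    then have "0 = (\<Sum>a\<in>pverts H. f (?\<psi> a) * g a)" using orth by metis
    also have "\<dots> = (\<Sum>u\<in>pverts G. f (?\<psi> (\<phi> u)) * g (\<phi> u))"
      by (rule graph_bijection_sum[OF assms(1), where h = "\<lambda>a. f (?\<psi> a) * g a", symmetric])
    also have "\<dots> = (\<Sum>u\<in>pverts G. f u * g (\<phi> u))"
      using the_inv_into_f_f[OF bij_betw_imp_inj_on[OF bij]] by (intro sum.cong refl) simp
    finally show ?thesis by simp
  qed
  then have "\<forall>u\<in>pverts G. g (\<phi> u) = 0"
    using signed_completeD[OF assms(2), of "\<lambda>u. g (\<phi> u)"] by blast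
  moreover have "\<phi> ` pverts G = pverts H" using bij by (simp add: bij_betw_def)
  ultimately show "\<forall>u\<in>pverts H. g u = 0" by (metis imageE)
qed

section \<open>Complements of unions of connected graphs\<close>

definition size_vector :: "'a pair_pre_digraph list \<Rightarrow> real vec" where
  "size_vector Gs = vec_of_list (map (\<lambda>H. real (card (pverts H))) Gs)"

lemma size_vector_simps:
  shows "size_vector Gs \<in> carrier_vec (length Gs)"
    and "i < length Gs \<Longrightarrow> size_vector Gs $ i = real (card (pverts (Gs ! i)))"
proof -
  show "size_vector Gs \<in> carrier_vec (length Gs)"
    by (rule carrier_vecI) (simp add: size_vector_def)
  show "i < length Gs \<Longrightarrow> size_vector Gs $ i = real (card (pverts (Gs ! i)))"
    unfolding size_vector_def vec_of_list_index by simp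
qed

text \<open>
The graph under study is the complement of \<open>U\<close>, the disjoint union of at least two connected graphs.
\<close>

locale connected_parts =
  fixes Gs :: "'a pair_pre_digraph list"
  assumes pg: "\<forall>H\<in>set Gs. pair_graph H"
    and conn: "\<forall>H\<in>set Gs. Digraph_Component.connected (with_proj H)"
    and len: "length Gs \<ge> 2"
begin

abbreviation "U \<equiv> disjoint_union Gs"
abbreviation "N \<equiv> real (card (pverts U))"
abbreviation "part_size i \<equiv> real (card (pverts (Gs ! i)))"

lemma parts_nonempty: "\<forall>H\<in>set Gs. pverts H \<noteq> {}"
  using conn connected_nonempty by blast

lemma pg_nth: "i < length Gs \<Longrightarrow> pair_graph (Gs ! i)"
  by (rule bspec[OF pg nth_mem])

lemma pgU: "pair_graph U"
  by (rule pair_graph_disjoint_union[OF pg])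

lemma part_size_pos: "i < length Gs \<Longrightarrow> part_size i > 0"
  using bspec[OF parts_nonempty nth_mem, of i] pair_graph_finite[OF pg_nth, of i] by (simp add: card_gt_0_iff)

lemma sum_union: "(\<Sum>p\<in>pverts U. F p) = (\<Sum>i<length Gs. \<Sum>w\<in>pverts (Gs ! i). F (i, w))"
  by (rule sum_disjoint_union[OF pg])

lemma N_eq: "N = (\<Sum>i<length Gs. part_size i)"
  using sum_union[of "\<lambda>_. 1 :: real"] by simp

lemma N_pos: "N > 0"
  unfolding N_eq using part_size_pos len by (intro sum_pos) (auto simp: lessThan_empty_iff)

lemma harmonic_on_part:
  fixes F :: "nat \<times> 'a \<Rightarrow> real"
  assumes "eigenfunction U 0 F" and i: "i < length Gs" "w \<in> pverts (Gs ! i)" "w' \<in> pverts (Gs ! i)"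
  shows "F (i, w) = F (i, w')"
proof -
  have "eigenfunction (Gs ! i) 0 (\<lambda>w. F (i, w))"
    using assms(1) i(1) eigenfunction_disjoint_union[OF pg] by blast
  then show ?thesis
    by (rule connected_harmonic_constant[OF pg_nth[OF i(1)] bspec[OF conn nth_mem[OF i(1)]] _ i(2,3)])
qed

lemma partwise_constant_harmonic: "eigenfunction U 0 (\<lambda>(i, w). a i)"
  by (simp add: eigenfunction_disjoint_union[OF pg] eigenfunction_const)

text \<open>
The hypothesis says that the function, which is harmonic on \<open>U\<close>, has sum zero. These functions form the
eigenspace of the complement for the eigenvalue \<open>N\<close>, and the condition on \<open>a\<close> is orthogonality to the
vector of part sizes.
\<close>

lemma partwise_constant_eigenfunction:
  assumes "(\<Sum>i<length Gs. part_size i * a i) = 0"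
  shows "eigenfunction (graph_complement U) N (\<lambda>(i, w). a i)"
proof -
  have "(\<Sum>p\<in>pverts U. (\<lambda>(i, w). a i) p) = 0" using assms unfolding sum_union by simp
  from eigenfunction_complement[OF pgU this partwise_constant_harmonic] show ?thesis by simp
qed

text \<open>
For \<open>k = 0\<close> the function is constant; otherwise it is an eigenfunction of \<open>U\<close> for \<open>N - k\<close>, and the
Laplacian of \<open>U\<close> acts on each part separately.
\<close>

lemma restrict_signed_eigenfunction:
  assumes f: "signed_eigenfunction (graph_complement U) k f" and i: "i < length Gs"
  shows "\<exists>l. signed_eigenfunction (Gs ! i) l (\<lambda>w. f (i, w))"
proof -
  have eig: "eigenfunction (graph_complement U) k f" and sgn: "\<forall>p\<in>pverts U. f p \<in> {-1,0,1}"
    using f by (simp_all add: signed_eigenfunction_def)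
  have in_U: "(i, w) \<in> pverts U" if "w \<in> pverts (Gs ! i)" for w
    using i that by (simp add: pverts_disjoint_union)
  have "\<exists>l. eigenfunction (Gs ! i) l (\<lambda>w. f (i, w))"
  proof (cases "k = 0")
    case True
    obtain u where u: "u \<in> pverts (Gs ! i)" using bspec[OF parts_nonempty nth_mem[OF i]] by blast
    have "f (i, w) = f (i, u)" if "w \<in> pverts (Gs ! i)" for w
      using complement_disjoint_union_harmonic[OF pg parts_nonempty len, of f] eig True in_U[OF u] in_U[OF that]
      by blast
    then have "eigenfunction (Gs ! i) 0 (\<lambda>w. f (i, w))"
      using eigenfunction_cong[of "Gs ! i" "\<lambda>w. f (i, w)" "\<lambda>_. f (i, u)"] eigenfunction_const by blast
    then show ?thesis by blast
  next
    case False
    have "eigenfunction U (of_nat (card (pverts U)) - k) f"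
      by (rule complement_eigenfunction_nonzero[OF pgU eig False])
    then show ?thesis using i eigenfunction_disjoint_union[OF pg] by blast
  qed
  then show ?thesis using sgn in_U by (auto simp: signed_eigenfunction_def)
qed

text \<open>
A function on one part that is orthogonal to all signed eigenfunctions of that part is, extended by
zero, orthogonal to all signed eigenfunctions of the whole graph.
\<close>

lemma signed_complete_part:
  assumes complete: "signed_complete (graph_complement U)" and i: "i < length Gs"
  shows "signed_complete (Gs ! i)"
  unfolding signed_complete_def
proof (intro allI impI ballI)
  fix g :: "'a \<Rightarrow> real" and u
  assume orth: "\<forall>f k. signed_eigenfunction (Gs ! i) k f \<longrightarrow> (\<Sum>u\<in>pverts (Gs ! i). f u * g u) = 0"
    and u: "u \<in> pverts (Gs ! i)"
  have "(\<lambda>(j, w). if j = i then g w else 0) (i, u) = 0"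
  proof (rule signed_completeD[OF complete])
    fix f k assume "signed_eigenfunction (graph_complement U) k f"
    then have "(\<Sum>w\<in>pverts (Gs ! i). g w * f (i, w)) = 0"
      using restrict_signed_eigenfunction[OF _ i] orth by (metis (no_types, lifting) mult.commute sum.cong)
    then have "(\<Sum>p\<in>pverts U. (case p of (j, w) \<Rightarrow> if j = i then g w else 0) * f p) = 0"
      using sum_extend[OF pg i, of g f] by simp
    then show "(\<Sum>p\<in>pverts (graph_complement U). f p * (case p of (j, w) \<Rightarrow> if j = i then g w else 0)) = 0"
      by (simp add: mult.commute)
  qed (use i u in \<open>simp add: pverts_disjoint_union\<close>)
  then show "g u = 0" by simp
qed

lemma size_vector_nonzero: "size_vector Gs \<noteq> 0\<^sub>v (length Gs)"
proof
  assume "size_vector Gs = 0\<^sub>v (length Gs)"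
  moreover have "0\<^sub>v (length Gs) $ 0 = (0 :: real)" using len by (intro index_zero_vec(1)) linarith
  ultimately have "size_vector Gs $ 0 = 0" by simp
  moreover have "0 < length Gs" using len by linarith
  ultimately show False using part_size_pos[of 0] size_vector_simps(2)[of 0 Gs] by simp
qed

lemma scalar_prod_size_vector:
  assumes "a \<in> carrier_vec (length Gs)"
  shows "a \<bullet> size_vector Gs = (\<Sum>i<length Gs. part_size i * a $ i)"
proof -
  have "dim_vec (size_vector Gs) = length Gs" using carrier_vecD[OF size_vector_simps(1)] .
  then show ?thesis by (simp add: scalar_prod_def size_vector_simps(2) atLeast0LessThan mult.commute)
qed

text \<open>
Given \<open>y\<close> orthogonal to all signed vectors orthogonal to the size vector, spread each \<open>y\<^sub>i\<close> evenly over
its part and subtract the mean \<open>c\<close>. The result lies in the eigenspace for \<open>N\<close>, so it is orthogonal to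
all eigenfunctions for other eigenvalues; and a signed eigenfunction for \<open>N\<close> is constant on the parts,
hence given by a signed vector orthogonal to the size vector. So the result is zero, which means that
\<open>y\<close> is \<open>c\<close> times the size vector.
\<close>

lemma balanced_if_signed_complete:
  assumes complete: "signed_complete (graph_complement U)"
  shows "balanced (size_vector Gs)"
  unfolding balanced_iff_orthogonal[OF size_vector_simps(1) len size_vector_nonzero]
proof (intro ballI impI)
  fix y :: "real vec" assume y: "y \<in> carrier_vec (length Gs)"
    and orth: "\<forall>a\<in>carrier_vec (length Gs). (\<forall>i<length Gs. a $ i \<in> {-1,0,1}) \<longrightarrow>
      a \<bullet> size_vector Gs = 0 \<longrightarrow> a \<bullet> y = 0"
  define c where "c = (\<Sum>i<length Gs. y $ i) / N"
  define b where "b i = y $ i / part_size i - c" for i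
  have size_b: "part_size i * b i = y $ i - c * part_size i" if "i < length Gs" for i
    using part_size_pos[OF that] by (simp add: b_def field_simps)
  have "(\<Sum>i<length Gs. part_size i * b i) = (\<Sum>i<length Gs. y $ i) - c * N"
    unfolding N_eq using size_b by (simp add: sum_subtractf sum_distrib_left)
  then have "(\<Sum>i<length Gs. part_size i * b i) = 0" using N_pos by (simp add: c_def)
  then have g: "eigenfunction (graph_complement U) N (\<lambda>(i, w). b i)"
    by (rule partwise_constant_eigenfunction)
  have zero: "(\<lambda>(i, w). b i) p = 0" if "p \<in> pverts (graph_complement U)" for p
  proof (rule signed_completeD[OF complete _ that])
    fix f k assume f: "signed_eigenfunction (graph_complement U) k f"
    then have eig: "eigenfunction (graph_complement U) k f" and sgn: "\<forall>p\<in>pverts U. f p \<in> {-1,0,1}"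
      by (simp_all add: signed_eigenfunction_def)
    show "(\<Sum>p\<in>pverts (graph_complement U). f p * (case p of (i, w) \<Rightarrow> b i)) = 0"
    \<comment> \<open>The function (i, w) \<mapsto> b i is an eigenfunction for N, so only k = N needs an argument.\<close>
    proof (cases "k = N")
      case False
      then show ?thesis
        by (rule eigenfunctions_orthogonal[OF pair_graph_complement[OF pgU] eig g])
    next
      case True
      have "k \<noteq> 0" using True N_pos by simp
      then have harm: "eigenfunction U 0 f"
        using complement_eigenfunction_nonzero[OF pgU eig] True by simp
      have "\<forall>i<length Gs. \<exists>u. u \<in> pverts (Gs ! i)" using bspec[OF parts_nonempty nth_mem] by blast
      then obtain rep where rep: "rep i \<in> pverts (Gs ! i)" if "i < length Gs" for i by metis
      define a where "a = vec (length Gs) (\<lambda>i. f (i, rep i))"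
      have fa: "f (i, w) = a $ i" if "i < length Gs" "w \<in> pverts (Gs ! i)" for i w
        using harmonic_on_part[OF harm that rep[OF that(1)]] that by (simp add: a_def)
      have "(\<Sum>p\<in>pverts U. f p) = 0"
        using eigenfunction_sum_zero[OF pair_graph_complement[OF pgU] eig \<open>k \<noteq> 0\<close>] by simp
      then have a0: "(\<Sum>i<length Gs. part_size i * a $ i) = 0" unfolding sum_union using fa by simp
      have "a $ i \<in> {-1,0,1}" if "i < length Gs" for i
        using sgn rep[OF that] that by (simp add: a_def pverts_disjoint_union)
      then have "a \<bullet> y = 0"
        using orth a0 scalar_prod_size_vector[of a] by (simp add: a_def)
      then have ay: "(\<Sum>i<length Gs. a $ i * y $ i) = 0"
        using y by (simp add: scalar_prod_def atLeast0LessThan)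
      have "(\<Sum>p\<in>pverts U. f p * (case p of (i, w) \<Rightarrow> b i)) = (\<Sum>i<length Gs. a $ i * (part_size i * b i))"
        unfolding sum_union using fa by (simp add: ac_simps)
      also have "\<dots> = (\<Sum>i<length Gs. a $ i * y $ i) - c * (\<Sum>i<length Gs. part_size i * a $ i)"
        using size_b by (simp add: sum_subtractf sum_distrib_left right_diff_distrib ac_simps)
      finally show ?thesis using ay a0 by simp
    qed
  qed
  have "y $ i = c * size_vector Gs $ i" if i: "i < length Gs" for i
  proof -
    obtain w where "w \<in> pverts (Gs ! i)" using bspec[OF parts_nonempty nth_mem[OF i]] by blast
    then have "b i = 0" using zero[of "(i, w)"] i by (simp add: pverts_disjoint_union)
    then show ?thesis using size_b[OF i] i by (simp add: size_vector_simps)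
  qed
  then have "y = c \<cdot>\<^sub>v size_vector Gs"
    using y carrier_vecD[OF size_vector_simps(1), of Gs] by (intro eq_vecI) auto
  then show "\<exists>c. y = c \<cdot>\<^sub>v size_vector Gs" by blast
qed

text \<open>
Let \<open>g\<close> be orthogonal to all signed eigenfunctions. Those that extend signed eigenfunctions of a part
for nonzero eigenvalues force \<open>g\<close> to be equal to its mean on that part, those that are constant on the
parts force, by balancedness, the means to agree, and the constant function forces them to be zero.
\<close>

lemma signed_complete_if_balanced:
  assumes parts: "\<forall>H\<in>set Gs. signed_complete H" and bal: "balanced (size_vector Gs)"
  shows "signed_complete (graph_complement U)"
  unfolding signed_complete_def
proof (intro allI impI)
  fix g :: "nat \<times> 'a \<Rightarrow> real"
  assume "\<forall>f k. signed_eigenfunction (graph_complement U) k f \<longrightarrow>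
    (\<Sum>p\<in>pverts (graph_complement U). f p * g p) = 0"
  then have orth: "(\<Sum>p\<in>pverts U. f p * g p) = 0"
    if "eigenfunction (graph_complement U) k f" "\<And>p. p \<in> pverts U \<Longrightarrow> f p \<in> {-1,0,1}" for f k
    using that by (metis pverts_graph_complement signed_eigenfunction_def)
  \<comment> \<open>The mean of g on part i.\<close>
  define c where "c i = (\<Sum>w\<in>pverts (Gs ! i). g (i, w)) / part_size i" for i
  have c: "(\<Sum>w\<in>pverts (Gs ! i). g (i, w)) = part_size i * c i" if "i < length Gs" for i
    using part_size_pos[OF that] by (simp add: c_def)
  have g_const: "g (i, w) = c i" if i: "i < length Gs" and w: "w \<in> pverts (Gs ! i)" for i w
  proof -
    have "(\<lambda>w. g (i, w) - c i) w = 0"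
    proof (rule signed_completeD[OF bspec[OF parts nth_mem[OF i]] _ w])
      fix f l assume f: "signed_eigenfunction (Gs ! i) l f"
      then have eig: "eigenfunction (Gs ! i) l f" and sgn: "\<forall>p\<in>pverts (Gs ! i). f p \<in> {-1,0,1}"
        by (simp_all add: signed_eigenfunction_def)
      show "(\<Sum>u\<in>pverts (Gs ! i). f u * (g (i, u) - c i)) = 0"
      proof (cases "l = 0")
        case True
        have "f u = f w" if "u \<in> pverts (Gs ! i)" for u
          using connected_harmonic_constant[OF pg_nth[OF i] bspec[OF conn nth_mem[OF i]] _ that w]
            eig True by simp
        then have "(\<Sum>u\<in>pverts (Gs ! i). f u * (g (i, u) - c i)) =
            f w * ((\<Sum>u\<in>pverts (Gs ! i). g (i, u)) - part_size i * c i)"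
          by (simp add: sum_distrib_left[symmetric] sum_subtractf)
        then show ?thesis using c[OF i] by simp
      next
        case False
        have f0: "(\<Sum>u\<in>pverts (Gs ! i). f u) = 0"
          by (rule eigenfunction_sum_zero[OF pg_nth[OF i] eig False])
        let ?F = "\<lambda>(j, w). if j = i then f w else 0"
        have "(\<Sum>p\<in>pverts U. ?F p) = 0" using sum_extend[OF pg i, of f "\<lambda>_. 1"] f0 by simp
        then have "eigenfunction (graph_complement U) (of_nat (card (pverts U)) - l) ?F"
          using eigenfunction_complement[OF pgU _ eigenfunction_extend[OF pg i eig]] by blast
        moreover have "?F p \<in> {-1,0,1}" if "p \<in> pverts U" for p
        proof (cases "fst p = i")
          case True
          have "snd p \<in> pverts (Gs ! fst p)"
            using that by (cases p) (simp add: pverts_disjoint_union)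
          then have "f (snd p) \<in> {-1,0,1}" using True bspec[OF sgn] by metis
          then show ?thesis using True by (cases p) simp
        qed (cases p, simp)
        ultimately have "(\<Sum>p\<in>pverts U. ?F p * g p) = 0" by (rule orth)
        then have "(\<Sum>u\<in>pverts (Gs ! i). f u * g (i, u)) = 0" using sum_extend[OF pg i, of f g] by simp
        then show ?thesis
          using f0 by (simp add: right_diff_distrib sum_subtractf sum_distrib_right[symmetric])
      qed
    qed
    then show ?thesis by simp
  qed
  \<comment> \<open>The scalar product of y with a is that of g with the function (i, w) \<mapsto> a $ i.\<close>
  define y where "y = vec (length Gs) (\<lambda>i. part_size i * c i)"
  have y: "y \<in> carrier_vec (length Gs)" by (simp add: y_def)
  have "a \<bullet> y = 0" if a: "a \<in> carrier_vec (length Gs)" "\<forall>i<length Gs. a $ i \<in> {-1,0,1}"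
    "a \<bullet> size_vector Gs = 0" for a
  proof -
    have "eigenfunction (graph_complement U) N (\<lambda>(i, w). a $ i)"
      using a(3) scalar_prod_size_vector[OF a(1)] by (intro partwise_constant_eigenfunction) simp
    then have "(\<Sum>p\<in>pverts U. (\<lambda>(i, w). a $ i) p * g p) = 0"
      using a(2) by (intro orth) (auto simp: pverts_disjoint_union)
    then show ?thesis unfolding sum_union
      using g_const by (simp add: y_def scalar_prod_def atLeast0LessThan ac_simps)
  qed
  then obtain t where t: "y = t \<cdot>\<^sub>v size_vector Gs"
    using bal y unfolding balanced_iff_orthogonal[OF size_vector_simps(1) len size_vector_nonzero] by blast
  have ct: "c i = t" if i: "i < length Gs" for i
  proof -
    have "y $ i = t * part_size i"
      unfolding t using i carrier_vecD[OF size_vector_simps(1), of Gs]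
      by (metis index_smult_vec(1) size_vector_simps(2))
    then show ?thesis using part_size_pos[OF i] i by (simp add: y_def)
  qed
  have "(\<Sum>p\<in>pverts U. 1 * g p) = 0" by (rule orth[OF eigenfunction_const]) simp
  then have "t * N = 0" unfolding sum_union N_eq using g_const ct by (simp add: sum_distrib_left mult.commute)
  then have "t = 0" using N_pos by simp
  then show "\<forall>p\<in>pverts (graph_complement U). g p = 0"
    using g_const ct by (auto simp: pverts_disjoint_union)
qed

lemma signed_complete_complement_union_iff:
  "signed_complete (graph_complement (disjoint_union Gs)) \<longleftrightarrow>
    (\<forall>H\<in>set Gs. signed_complete H) \<and> balanced (size_vector Gs)"
  using signed_complete_part balanced_if_signed_complete signed_complete_if_balanced
  by (metis in_set_conv_nth)

end

section \<open>Connected components\<close>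

text \<open>
The parts are the classes of the reachability relation, transported to natural numbers by an injection
\<open>e\<close>; a vertex is sent to the index of its class paired with its number.
\<close>

lemma components_as_disjoint_union:
  assumes pg: "pair_graph H"
  shows "\<exists>(Gs :: nat pair_pre_digraph list) \<phi>.
    (\<forall>K\<in>set Gs. pair_graph K \<and> Digraph_Component.connected (with_proj K)) \<and>
    graph_bijection \<phi> H (disjoint_union Gs)"
proof -
  let ?V = "pverts H" and ?E = "parcs H"
  define R where "R = {(u, v). u \<in> ?V \<and> v \<in> ?V \<and> (u, v) \<in> ?E\<^sup>*}"
  have fin: "finite ?V" by (rule pair_graph_finite[OF pg])
  have "sym ?E" using pair_graph_arcs(4)[OF pg] by (rule symI)
  then have "sym (?E\<^sup>*)" by (rule sym_rtrancl)
  then have equiv: "equiv ?V R"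
    by (intro equivI) (auto simp: R_def refl_on_def sym_def trans_def)
  have "finite (?V // R)"
    using fin equiv by (intro finite_quotient) (auto simp: equiv_def R_def)
  then obtain Cs where Cs: "set Cs = ?V // R" "distinct Cs" using finite_distinct_list by blast
  obtain e :: "'a \<Rightarrow> nat" where e: "inj_on e ?V"
    using finite_imp_inj_to_nat_seg[OF fin] by blast
  define part where "part C = \<lparr> pverts = e ` C,
      parcs = {(e u, e v) | u v. u \<in> C \<and> v \<in> C \<and> (u, v) \<in> ?E} \<rparr>" for C
  define Gs where "Gs = map part Cs"
  have class_sub: "C \<subseteq> ?V" if "C \<in> set Cs" for C
    using that Cs(1) equiv by (auto simp: quotient_def R_def)
  have class_closed: "v \<in> C \<longleftrightarrow> (u, v) \<in> ?E\<^sup>*" if "C \<in> set Cs" "u \<in> C" "v \<in> ?V" for C u v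
  proof -
    have "C = R `` {u}"
      using that Cs(1) equiv by (metis Image_singleton_iff equiv_class_eq quotientE)
    then show ?thesis using that class_sub by (auto simp: R_def)
  qed
  have part_graph: "pair_graph (part C)" if C: "C \<in> set Cs" for C
  proof (rule pair_graphI)
    show "finite (pverts (part C))"
      using finite_subset[OF class_sub[OF C] fin] by (simp add: part_def)
    fix a b assume "(a, b) \<in> parcs (part C)"
    then obtain u v where uv: "a = e u" "b = e v" "u \<in> C" "v \<in> C" "(u, v) \<in> ?E"
      by (auto simp: part_def)
    have "e u \<noteq> e v"
      using e pair_graph_arcs[OF pg uv(5)] by (auto dest: inj_onD)
    then show "a \<in> pverts (part C) \<and> b \<in> pverts (part C) \<and> a \<noteq> b \<and> (b, a) \<in> parcs (part C)"
      using uv pair_graph_arcs(4)[OF pg uv(5)] by (auto simp: part_def)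
  qed
  have part_connected: "Digraph_Component.connected (with_proj (part C))" if C: "C \<in> set Cs" for C
    unfolding connected_iff_rtrancl[OF part_graph[OF C]]
  proof (intro conjI ballI)
    show "pverts (part C) \<noteq> {}"
      using C Cs(1) equiv in_quotient_imp_non_empty by (fastforce simp: part_def)
    fix a b assume "a \<in> pverts (part C)" "b \<in> pverts (part C)"
    then obtain u v where uv: "a = e u" "b = e v" "u \<in> C" "v \<in> C" by (auto simp: part_def)
    have "(u, v) \<in> ?E\<^sup>*" using class_closed[OF C uv(3)] uv(4) class_sub[OF C] by blast
    then have "v \<in> C \<and> (e u, e v) \<in> (parcs (part C))\<^sup>*"
    proof (induction rule: rtrancl_induct)
      case base
      then show ?case using uv by simp
    next
      case (step y z)
      have "z \<in> C"
        using class_closed[OF C, of y z] step pair_graph_arcs(2)[OF pg step(2)] by blast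
      then have "(e y, e z) \<in> parcs (part C)" using step by (auto simp: part_def)
      then show ?case using step \<open>z \<in> C\<close> by (meson rtrancl.rtrancl_into_rtrancl)
    qed
    then show "(a, b) \<in> (parcs (part C))\<^sup>*" using uv by simp
  qed
  have "\<exists>i<length Cs. u \<in> Cs ! i" if "u \<in> ?V" for u
  proof -
    have "R `` {u} \<in> set Cs" unfolding Cs(1) by (rule quotientI[OF that])
    moreover have "u \<in> R `` {u}" using that by (simp add: R_def)
    ultimately show ?thesis by (metis in_set_conv_nth)
  qed
  then obtain ix where ix: "ix u < length Cs" "u \<in> Cs ! ix u" if "u \<in> ?V" for u by metis
  have ix_eq: "ix u = i" if i: "i < length Cs" "u \<in> Cs ! i" for i u
  proof -
    have u: "u \<in> ?V" using class_sub[OF nth_mem[OF i(1)]] i(2) by blast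
    have "Cs ! ix u = Cs ! i"
      using class_closed[OF nth_mem[OF i(1)] i(2)] class_closed[OF nth_mem[OF ix(1)[OF u]] ix(2)[OF u]]
        class_sub[OF nth_mem[OF i(1)]] class_sub[OF nth_mem[OF ix(1)[OF u]]] by blast
    then show ?thesis using Cs(2) ix(1)[OF u] i(1) nth_eq_iff_index_eq by blast
  qed
  define \<phi> where "\<phi> u = (ix u, e u)" for u
  have "bij_betw \<phi> ?V (pverts (disjoint_union Gs))"
    unfolding bij_betw_def
  proof (intro conjI equalityI subsetI)
    show "inj_on \<phi> ?V" using e by (auto simp: \<phi>_def inj_on_def)
    fix p
    show "p \<in> pverts (disjoint_union Gs)" if p: "p \<in> \<phi> ` ?V"
      using p ix by (auto simp: \<phi>_def pverts_disjoint_union Gs_def part_def)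
    show "p \<in> \<phi> ` ?V" if p: "p \<in> pverts (disjoint_union Gs)"
    proof -
      obtain i u where iu: "p = (i, e u)" "i < length Cs" "u \<in> Cs ! i"
        using p by (auto simp: pverts_disjoint_union Gs_def part_def)
      then show ?thesis
        using ix_eq[OF iu(2,3)] class_sub[OF nth_mem[OF iu(2)]] by (auto simp: \<phi>_def)
    qed
  qed
  moreover have "(u, v) \<in> ?E \<longleftrightarrow> (\<phi> u, \<phi> v) \<in> parcs (disjoint_union Gs)" if uv: "u \<in> ?V" "v \<in> ?V" for u v
  proof
    assume uvE: "(u, v) \<in> ?E"
    have "v \<in> Cs ! ix u"
      using class_closed[OF nth_mem[OF ix(1)[OF uv(1)]] ix(2)[OF uv(1)] uv(2)] uvE by blast
    moreover from this have "ix v = ix u" using ix_eq[OF ix(1)[OF uv(1)]] by blast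
    ultimately show "(\<phi> u, \<phi> v) \<in> parcs (disjoint_union Gs)"
      using ix[OF uv(1)] uvE by (auto simp: \<phi>_def arcs_disjoint_union Gs_def part_def)
  next
    assume "(\<phi> u, \<phi> v) \<in> parcs (disjoint_union Gs)"
    then obtain u' v' where *: "e u = e u'" "e v = e v'" "(u', v') \<in> ?E"
      using ix[OF uv(1)] by (auto simp: \<phi>_def arcs_disjoint_union Gs_def part_def)
    then have "u = u'" "v = v'" using e uv pair_graph_arcs(1,2)[OF pg *(3)] by (auto dest: inj_onD)
    then show "(u, v) \<in> ?E" using *(3) by simp
  qed
  ultimately have "graph_bijection \<phi> H (disjoint_union Gs)" by (simp add: graph_bijection_def)
  moreover have "\<forall>K\<in>set Gs. pair_graph K \<and> Digraph_Component.connected (with_proj K)"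
    using part_graph part_connected by (simp add: Gs_def)
  ultimately show ?thesis by blast
qed

section \<open>Integral graphs of prime order\<close>

text \<open>
Applied to a graph and to its complement, this bounds the eigenvalues for functions of sum zero from
below by \<open>0\<close> and from above by the number of vertices.
\<close>

lemma eigenvalue_nonneg:
  fixes f :: "'a \<Rightarrow> real"
  assumes pg: "pair_graph H" and f: "eigenfunction H k f" and u: "u \<in> pverts H" "f u \<noteq> 0"
  shows "k \<ge> 0"
proof -
  have "2 * (k * (\<Sum>u\<in>pverts H. f u * f u)) = 2 * (\<Sum>u\<in>pverts H. laplacian H f u * f u)"
    using f by (simp add: sum_distrib_left eigenfunction_def mult.assoc)
  also have "\<dots> \<ge> 0"
    unfolding sum_laplacian_mult[OF pg] by (intro sum_nonneg) simp
  finally have "k * (\<Sum>u\<in>pverts H. f u * f u) \<ge> 0" by simp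
  moreover have "(\<Sum>u\<in>pverts H. f u * f u) > 0"
    using pair_graph_finite[OF pg] u by (intro sum_pos2[of _ u]) (auto simp: zero_less_mult_iff)
  ultimately show ?thesis by (simp add: zero_le_mult_iff)
qed

lemma real_eigenfunction_of_complex:
  fixes f :: "'a \<Rightarrow> complex"
  assumes "eigenfunction H (complex_of_real k) f" "\<exists>u\<in>pverts H. f u \<noteq> 0" "(\<Sum>u\<in>pverts H. f u) = 0"
  obtains g where "eigenfunction H k g" "\<exists>u\<in>pverts H. g u \<noteq> 0" "(\<Sum>u\<in>pverts H. g u) = 0"
proof -
  have "laplacian H (\<lambda>u. Re (f u)) u = Re (laplacian H f u)"
    "laplacian H (\<lambda>u. Im (f u)) u = Im (laplacian H f u)" for u
    by (auto simp: laplacian_def intro!: sum.cong)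
  then have "eigenfunction H k (\<lambda>u. Re (f u))" "eigenfunction H k (\<lambda>u. Im (f u))"
    using assms(1) by (simp_all add: eigenfunction_def)
  moreover have "(\<Sum>u\<in>pverts H. Re (f u)) = 0" "(\<Sum>u\<in>pverts H. Im (f u)) = 0"
    using assms(3) by (metis Re_sum zero_complex.sel(1), metis Im_sum zero_complex.sel(2))
  moreover have "(\<exists>u\<in>pverts H. Re (f u) \<noteq> 0) \<or> (\<exists>u\<in>pverts H. Im (f u) \<noteq> 0)"
    using assms(2) complex_eq_iff by auto
  ultimately show thesis using that by blast
qed

lemma prod_list_uminus_of_int: "(\<Prod>k\<leftarrow>ks. - complex_of_int k) = complex_of_int (\<Prod>k\<leftarrow>ks. - k)"
  by (induction ks) simp_all

lemma prime_dvd_prod_list_uminus: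
  assumes "prime (p :: int)" "p dvd (\<Prod>k\<leftarrow>ks. - k)"
  obtains k where "k \<in> set ks" "p dvd k"
  using assms(2) that
proof (induction ks)
  case Nil
  then show ?case using assms(1) not_prime_unit by auto
next
  case (Cons a ks)
  then show ?case using prime_dvd_mult_iff[OF assms(1)] by auto
qed

text \<open>
In matrix terms: the determinant of \<open>K\<close> below is the product of its complex eigenvalues, all of which
are integers, and it is divisible by \<open>n\<close>. None of the eigenvalues other than \<open>n\<close> itself is divisible
by the prime \<open>n\<close>.
\<close>

lemma prime_integral_top_eigenvalue:
  fixes G :: "'a pair_pre_digraph"
  assumes pr: "prime n" and pg: "pair_graph G" and conn: "Digraph_Component.connected (with_proj G)"
    and card: "card (pverts G) = n" and int: "laplacian_integral G"
  shows "\<exists>f :: 'a \<Rightarrow> real. eigenfunction G (real n) f \<and> (\<exists>u\<in>pverts G. f u \<noteq> 0) \<and>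
    (\<Sum>u\<in>pverts G. f u) = 0" (is ?top)
proof -
  obtain vs where vs: "vertex_enumeration G vs"
    using vertex_enumeration_exists[OF pair_graph_finite[OF pg]] by blast
  have len: "length vs = n"
    using vs card distinct_card unfolding vertex_enumeration_def by metis
  have n0: "0 < n" using prime_gt_0_nat[OF pr] .
  \<comment> \<open>The Laplacian matrix plus the matrix whose first row is constant 1 and whose other rows vanish.\<close>
  define K :: "int mat" where "K = mat n n (\<lambda>(i, j).
      (if i = j then (\<Sum>w\<in>pverts G. if (vs ! i, w) \<in> parcs G then 1 else 0) else 0) -
      (if (vs ! i, vs ! j) \<in> parcs G then 1 else 0) + (if i = 0 then 1 else 0))"
  have K: "K \<in> carrier_mat n n" by (simp add: K_def)
  define A where "A = map_mat complex_of_int K"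
  have A: "A \<in> carrier_mat n n" using K by (simp add: A_def)
  \<comment> \<open>K maps the all-ones vector to n times the first unit vector; apply the adjugate and compare the
    first entries.\<close>
  have dvd_det: "int n dvd det K"
  proof -
    have "K *\<^sub>v vec n (\<lambda>_. 1) = vec n (\<lambda>i. if i = 0 then int n else 0)"
    proof (intro eq_vecI)
      fix i assume "i < dim_vec (vec n (\<lambda>i. if i = 0 then int n else 0))"
      then have i: "i < n" by simp
      have "(K *\<^sub>v vec n (\<lambda>_. 1)) $ i = (\<Sum>j<n. K $$ (i, j))"
        using i K by (simp add: scalar_prod_def atLeast0LessThan)
      also have "\<dots> = (\<Sum>j<n. if i = j then (\<Sum>w\<in>pverts G. if (vs ! i, w) \<in> parcs G then 1 else 0) else 0) -
          (\<Sum>j<n. if (vs ! i, vs ! j) \<in> parcs G then 1 else 0) + (\<Sum>j<n. if i = 0 then 1 else 0)"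
        using i unfolding sum_subtractf[symmetric] sum.distrib[symmetric]
        by (intro sum.cong refl) (simp add: K_def)
      also have "\<dots> = (if i = 0 then int n else 0)"
        using i sum_enumeration[OF vs, of "\<lambda>w. if (vs ! i, w) \<in> parcs G then 1 else 0 :: int"] len by simp
      finally show "(K *\<^sub>v vec n (\<lambda>_. 1)) $ i = vec n (\<lambda>i. if i = 0 then int n else 0) $ i"
        using i by simp
    qed (use K in simp)
    then have "(adj_mat K * K) *\<^sub>v vec n (\<lambda>_. 1) = adj_mat K *\<^sub>v vec n (\<lambda>i. if i = 0 then int n else 0)"
      using assoc_mult_mat_vec[OF adj_mat(1)[OF K] K, of "vec n (\<lambda>_. 1)"] by simp
    moreover have "((adj_mat K * K) *\<^sub>v vec n (\<lambda>_. 1)) $ 0 = det K"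
      unfolding adj_mat(3)[OF K] using n0 by (simp add: scalar_prod_def if_distrib[of "\<lambda>x. det K * x"] cong: if_cong)
    moreover have "(adj_mat K *\<^sub>v vec n (\<lambda>i. if i = 0 then int n else 0)) $ 0 = adj_mat K $$ (0, 0) * int n"
      using n0 adj_mat(1)[OF K]
      by (simp add: scalar_prod_def if_distrib[of "\<lambda>x. _ * x"] sum.delta cong: if_cong)
    ultimately show ?thesis by (metis dvd_triv_right)
  qed
  have A_mult: "(A *\<^sub>v vec n (\<lambda>j. f (vs ! j))) $ i =
      laplacian G f (vs ! i) + (if i = 0 then (\<Sum>u\<in>pverts G. f u) else 0)" if i: "i < n" for f i
  proof -
    let ?L = "map_mat complex_of_real (laplacian_matrix G vs)"
    have "A $$ (i, j) = ?L $$ (i, j) + (if i = 0 then 1 else 0)" if j: "j < n" for j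
    proof -
      have deg: "complex_of_int (\<Sum>w\<in>pverts G. if (vs ! i, w) \<in> parcs G then 1 else 0) =
          complex_of_real (\<Sum>w\<in>pverts G. if (vs ! i, w) \<in> parcs G then 1 else 0)"
        unfolding of_int_sum of_real_sum by (intro sum.cong refl) simp
      have "?L $$ (i, j) = complex_of_real (laplacian_matrix G vs $$ (i, j))"
        using i j len laplacian_matrix_carrier[of G vs] by simp
      also have "\<dots> =
          (if i = j then complex_of_real (\<Sum>w\<in>pverts G. if (vs ! i, w) \<in> parcs G then 1 else 0) else 0) -
          (if (vs ! i, vs ! j) \<in> parcs G then 1 else 0)"
        unfolding laplacian_matrix_index[OF vs pg i[folded len] j[folded len]] by simp
      finally have L: "?L $$ (i, j) = \<dots>" .
      have "A $$ (i, j) =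
          (if i = j then complex_of_int (\<Sum>w\<in>pverts G. if (vs ! i, w) \<in> parcs G then 1 else 0) else 0) -
          (if (vs ! i, vs ! j) \<in> parcs G then 1 else 0) + (if i = 0 then 1 else 0)"
        using i j K by (simp add: A_def K_def del: of_int_sum)
      then show ?thesis unfolding L deg .
    qed
    then have "(A *\<^sub>v vec n (\<lambda>j. f (vs ! j))) $ i =
        (\<Sum>j<n. ?L $$ (i, j) * f (vs ! j)) + (\<Sum>j<n. if i = 0 then f (vs ! j) else 0)"
      using i A unfolding sum.distrib[symmetric]
      by (auto simp: scalar_prod_def atLeast0LessThan algebra_simps intro!: sum.cong)
    also have "(\<Sum>j<n. ?L $$ (i, j) * f (vs ! j)) = (?L *\<^sub>v vec n (\<lambda>j. f (vs ! j))) $ i"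
      using i len laplacian_matrix_carrier[of G vs] by (simp add: scalar_prod_def atLeast0LessThan)
    also have "\<dots> = laplacian G f (vs ! i)"
      using laplacian_matrix_mult_vec[OF vs pg, of i f] i len by simp
    finally show ?thesis using sum_enumeration[OF vs, of f] len by simp
  qed
  \<comment> \<open>An eigenvalue divisible by n is shown to be n, with a real eigenfunction as claimed; the primality
    of n then provides such an eigenvalue.\<close>
  have root: "\<exists>k. a = of_int k \<and> (int n dvd k \<longrightarrow> ?top)" if a: "eigenvalue A a" for a
  proof -
    obtain v where v: "v \<in> carrier_vec n" "v \<noteq> 0\<^sub>v n" "A *\<^sub>v v = a \<cdot>\<^sub>v v"
      using a A by (auto simp: eigenvalue_def eigenvector_def)
    then obtain f where f: "v = vec n (\<lambda>j. f (vs ! j))" using function_of_vec[OF vs] len by metis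
    obtain i where i: "i < n" "f (vs ! i) \<noteq> 0" using v(2) f by (auto simp: vec_eq_iff)
    then have nz: "\<exists>u\<in>pverts G. f u \<noteq> 0"
      using vs len unfolding vertex_enumeration_def by (metis nth_mem)
    have lap: "laplacian G f (vs ! j) + (if j = 0 then (\<Sum>u\<in>pverts G. f u) else 0) = a * f (vs ! j)"
      if j: "j < n" for j
      using A_mult[OF j, of f] v(3) j f by simp
    \<comment> \<open>Summing all entries of A v = a v removes the Laplacian, so a = 1 unless f has sum zero; in the
      latter case K acts on f like the Laplacian.\<close>
    have "(\<Sum>j<n. laplacian G f (vs ! j) + (if j = 0 then (\<Sum>u\<in>pverts G. f u) else 0)) =
        (\<Sum>j<n. a * f (vs ! j))" using lap by simp
    then have sum: "(\<Sum>u\<in>pverts G. f u) = a * (\<Sum>u\<in>pverts G. f u)"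
      using sum_enumeration[OF vs, of "laplacian G f"] sum_enumeration[OF vs, of f] len n0
        sum_laplacian[OF pg, of f]
      by (simp add: sum.distrib sum_distrib_left[symmetric])
    show ?thesis
    proof (cases "(\<Sum>u\<in>pverts G. f u) = 0")
      case False
      then have "a = of_int 1" using sum by simp
      moreover have "\<not> int n dvd 1" using prime_gt_1_nat[OF pr] by simp
      ultimately show ?thesis by blast
    next
      case True
      have eig: "eigenfunction G a f" unfolding eigenfunction_def
      proof
        fix u assume "u \<in> pverts G"
        then obtain j where "j < n" "vs ! j = u" using enumeration_surj[OF vs] len by metis
        then show "laplacian G f u = a * f u" using lap[of j] True by (cases "j = 0") simp_all
      qed
      then have "a \<in> \<int>" using int nz unfolding laplacian_integral_iff[OF pg] by blast
      then obtain k where k: "a = of_int k" by (elim Ints_cases)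
      obtain g where g: "eigenfunction G (real_of_int k) g" "\<exists>u\<in>pverts G. g u \<noteq> 0"
          "(\<Sum>u\<in>pverts G. g u) = 0"
        using real_eigenfunction_of_complex[of G "real_of_int k" f] eig nz True k by auto
      then obtain u where u: "u \<in> pverts G" "g u \<noteq> 0" by blast
      have "k \<ge> 0" using eigenvalue_nonneg[OF pg g(1) u] by simp
      moreover have "k \<noteq> 0"
      proof
        assume "k = 0"
        then have "g w = g u" if "w \<in> pverts G" for w
          using connected_harmonic_constant[OF pg conn _ that u(1), of g] g(1) by simp
        then have "(\<Sum>w\<in>pverts G. g w) = real n * g u" using card by simp
        then show False using g(3) u(2) n0 by simp
      qed
      moreover have "real_of_int k \<le> real n"
        using eigenvalue_nonneg[OF pair_graph_complement[OF pg] eigenfunction_complement[OF pg g(3,1)]] u card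
        by simp
      then have "k \<le> int n" by linarith
      ultimately have "int n dvd k \<Longrightarrow> k = int n"
        using zdvd_imp_le[of "int n" k] by simp
      then have "int n dvd k \<longrightarrow> ?top" using g by (auto intro!: exI[of _ g])
      then show ?thesis using k by blast
    qed
  qed
  obtain as where as: "char_poly A = (\<Prod>a\<leftarrow>as. [:- a, 1:])" "length as = n"
    using char_poly_factorized[OF A] by blast
  have "eigenvalue A a" if a: "a \<in> set as" for a
    unfolding eigenvalue_root_char_poly[OF A] as(1)
    using a by (induction as) auto
  then obtain h where h: "a = of_int (h a)" "int n dvd h a \<longrightarrow> ?top" if "a \<in> set as" for a
    using root by metis
  have "poly (\<Prod>a\<leftarrow>xs. [:- a, 1:]) 0 = (\<Prod>a\<leftarrow>xs. - a)" for xs :: "complex list"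
    by (induction xs) simp_all
  then have "poly (char_poly A) 0 = (\<Prod>a\<leftarrow>as. - a)" unfolding as(1) .
  also have "map uminus as = map (\<lambda>k. - complex_of_int k) (map h as)" using h(1) by simp
  finally have "poly (char_poly A) 0 = (\<Prod>k\<leftarrow>map h as. - complex_of_int k)" .
  moreover have "poly (char_poly A) 0 = of_int ((-1) ^ n * det K)"
  proof -
    have "char_matrix A 0 = A" using A by (intro eq_matI) (auto simp: char_matrix_def)
    then have "poly (char_poly A) 0 = det (- A)" using char_poly_matrix[OF A, of 0] by simp
    also have "- A = (-1) \<cdot>\<^sub>m A" by (intro eq_matI) auto
    also have "det \<dots> = (-1) ^ n * det A" using A by simp
    also have "det A = of_int (det K)" unfolding A_def by simp
    finally show ?thesis by simp
  qed
  ultimately have "(\<Prod>k\<leftarrow>map h as. - k) = (-1) ^ n * det K"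
    unfolding prod_list_uminus_of_int by (metis of_int_eq_iff)
  then have "int n dvd (\<Prod>k\<leftarrow>map h as. - k)" using dvd_det by simp
  moreover have "prime (int n)" using pr by simp
  ultimately obtain k where "k \<in> set (map h as)" "int n dvd k"
    using prime_dvd_prod_list_uminus by blast
  then show ?thesis using h(2) by auto
qed

section \<open>The decomposition\<close>

text \<open>
With a single component, an eigenfunction for the eigenvalue \<open>n\<close>, being harmonic on the complement,
would be constant and hence zero, as its sum is zero.
\<close>

lemma prime_integral_decomposition:
  assumes pr: "prime n" and pg: "pair_graph G" and conn: "Digraph_Component.connected (with_proj G)"
    and card: "card (pverts G) = n" and int: "laplacian_integral G"
  shows "\<exists>Gs. integral_decomposition G Gs"
proof -
  obtain f :: "'a \<Rightarrow> real" where f: "eigenfunction G (real n) f" "\<exists>u\<in>pverts G. f u \<noteq> 0"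
      "(\<Sum>u\<in>pverts G. f u) = 0"
    using prime_integral_top_eigenvalue[OF assms] by blast
  have harm: "eigenfunction (graph_complement G) 0 f"
    using eigenfunction_complement[OF pg f(3,1)] card by simp
  obtain Gs :: "nat pair_pre_digraph list" and \<phi> where
    parts: "\<forall>K\<in>set Gs. pair_graph K \<and> Digraph_Component.connected (with_proj K)"
    and \<phi>: "graph_bijection \<phi> (graph_complement G) (disjoint_union Gs)"
    using components_as_disjoint_union[OF pair_graph_complement[OF pg]] by blast
  have pgs: "\<forall>K\<in>set Gs. pair_graph K" and conns: "\<forall>K\<in>set Gs. Digraph_Component.connected (with_proj K)"
    using parts by simp_all
  have bij: "\<phi> ` pverts G = pverts (disjoint_union Gs)" "inj_on \<phi> (pverts G)"
    using \<phi> by (auto simp: graph_bijection_def bij_betw_def)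
  have "\<not> length Gs < 2"
  proof
    assume short: "length Gs < 2"
    define \<psi> where "\<psi> = the_inv_into (pverts G) \<phi>"
    have inv: "graph_bijection \<psi> (disjoint_union Gs) (graph_complement G)"
      using graph_bijection_inverse[OF \<phi>] by (simp add: \<psi>_def)
    have harmU: "eigenfunction (disjoint_union Gs) 0 (\<lambda>p. f (\<psi> p))"
      by (rule graph_bijection_eigenfunction[OF inv harm])
    have same: "f u = f v" if uv: "u \<in> pverts G" "v \<in> pverts G" for u v
    proof -
      have "\<phi> u \<in> pverts (disjoint_union Gs)" "\<phi> v \<in> pverts (disjoint_union Gs)"
        using bij(1) uv by blast+
      then obtain i a j b where ia: "\<phi> u = (i, a)" "i < length Gs" "a \<in> pverts (Gs ! i)"
        and jb: "\<phi> v = (j, b)" "j < length Gs" "b \<in> pverts (Gs ! j)"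
        by (auto simp: pverts_disjoint_union)
      have "j = i" using short ia(2) jb(2) by linarith
      have "eigenfunction (Gs ! i) 0 (\<lambda>w. f (\<psi> (i, w)))"
        using harmU ia(2) eigenfunction_disjoint_union[OF pgs, of 0 "\<lambda>p. f (\<psi> p)"] by simp
      then have "f (\<psi> (i, a)) = f (\<psi> (i, b))"
        using connected_harmonic_constant[OF bspec[OF pgs nth_mem[OF ia(2)]]
            bspec[OF conns nth_mem[OF ia(2)]] _ ia(3), of "\<lambda>w. f (\<psi> (i, w))" b] jb \<open>j = i\<close> by simp
      moreover have "\<psi> (i, a) = u" "\<psi> (i, b) = v"
        using the_inv_into_f_f[OF bij(2)] uv ia(1) jb(1) \<open>j = i\<close> by (metis \<psi>_def)+
      ultimately show ?thesis by simp
    qed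
    obtain u where u: "u \<in> pverts G" "f u \<noteq> 0" using f(2) by blast
    have "(\<Sum>v\<in>pverts G. f v) = (\<Sum>v\<in>pverts G. f u)" by (intro sum.cong refl same u(1))
    then show False using f(3) u card prime_gt_0_nat[OF pr] by simp
  qed
  moreover have "laplacian_integral (disjoint_union Gs)"
    by (rule laplacian_integral_bijection[OF pair_graph_complement[OF pg] pair_graph_disjoint_union[OF pgs] \<phi>
          laplacian_integral_complement[OF pg int]])
  then have "\<forall>K\<in>set Gs. laplacian_integral K" using laplacian_integral_disjoint_union[OF pgs] by blast
  moreover have "graph_bijection \<phi> G (graph_complement (disjoint_union Gs))"
    using graph_bijection_complement[OF \<phi>] by (simp add: graph_complement_involution[OF pg])
  then have "digraph_iso (with_proj G) (with_proj (graph_complement (disjoint_union Gs)))"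
    using digraph_iso_iff_bijection[OF pg pair_graph_complement[OF pair_graph_disjoint_union[OF pgs]]] by blast
  ultimately show ?thesis
    using parts unfolding integral_decomposition_def by (intro exI[of _ Gs]) auto
qed

lemma integral_decompositionD:
  assumes pg: "pair_graph G" and dec: "integral_decomposition G Gs"
  shows "\<forall>H\<in>set Gs. pair_graph H" "\<forall>H\<in>set Gs. Digraph_Component.connected (with_proj H)"
    "\<forall>H\<in>set Gs. laplacian_integral H" "length Gs \<ge> 2"
    "\<exists>\<phi>. graph_bijection \<phi> G (graph_complement (disjoint_union Gs))"
proof -
  show pgs: "\<forall>H\<in>set Gs. pair_graph H" using dec by (simp add: integral_decomposition_def)
  show "\<forall>H\<in>set Gs. Digraph_Component.connected (with_proj H)"
    "\<forall>H\<in>set Gs. laplacian_integral H" "length Gs \<ge> 2"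
    using dec by (simp_all add: integral_decomposition_def)
  show "\<exists>\<phi>. graph_bijection \<phi> G (graph_complement (disjoint_union Gs))"
    using dec digraph_iso_iff_bijection[OF pg pair_graph_complement[OF pair_graph_disjoint_union[OF pgs]]]
    by (simp add: integral_decomposition_def)
qed

lemma integral_of_decomposition:
  assumes pg: "pair_graph G" and dec: "integral_decomposition G Gs"
  shows "laplacian_integral G"
proof -
  note d = integral_decompositionD[OF assms]
  have pgU: "pair_graph (disjoint_union Gs)" by (rule pair_graph_disjoint_union[OF d(1)])
  have "laplacian_integral (disjoint_union Gs)" using laplacian_integral_disjoint_union[OF d(1)] d(3) by blast
  then have "laplacian_integral (graph_complement (disjoint_union Gs))"
    by (rule laplacian_integral_complement[OF pgU])
  then show ?thesis
    using d(5) graph_bijection_inverse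
      laplacian_integral_bijection[OF pair_graph_complement[OF pgU] pg] by metis
qed

lemma signed_diagonalizable_decomposition:
  assumes pg: "pair_graph G" and dec: "integral_decomposition G Gs"
  shows "signed_diagonalizable G \<longleftrightarrow>
    (\<forall>H\<in>set Gs. signed_diagonalizable H) \<and> balanced (size_vector Gs)"
proof -
  note d = integral_decompositionD[OF assms]
  obtain \<phi> where \<phi>: "graph_bijection \<phi> G (graph_complement (disjoint_union Gs))" using d(5) by blast
  have "signed_diagonalizable G \<longleftrightarrow> signed_complete (graph_complement (disjoint_union Gs))"
    unfolding signed_diagonalizable_iff[OF pg]
    using signed_complete_bijection[OF \<phi>] signed_complete_bijection[OF graph_bijection_inverse[OF \<phi>]] by blast
  also have "\<dots> \<longleftrightarrow> (\<forall>H\<in>set Gs. signed_complete H) \<and> balanced (size_vector Gs)"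
    by (rule connected_parts.signed_complete_complement_union_iff[OF connected_parts.intro[OF d(1,2,4)]])
  also have "(\<forall>H\<in>set Gs. signed_complete H) \<longleftrightarrow> (\<forall>H\<in>set Gs. signed_diagonalizable H)"
    using signed_diagonalizable_iff bspec[OF d(1)] by metis
  finally show ?thesis .
qed

theorem theorem1:
  fixes G :: "'a pair_pre_digraph" and n :: nat
  assumes "prime n"
    and "pair_graph G"
    and "Digraph_Component.connected (with_proj G)"
    and "card (pverts G) = n"
  shows "(laplacian_integral G \<longleftrightarrow> (\<exists>Gs. integral_decomposition G Gs)) \<and>
    (signed_diagonalizable G \<longleftrightarrow>
      (\<exists>Gs. integral_decomposition G Gs \<and>
        (\<forall>H \<in> set Gs. signed_diagonalizable H) \<and>
        balanced (vec_of_list (map (\<lambda>H. real (card (pverts H))) Gs))))"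
proof -
  have 1: "laplacian_integral G \<longleftrightarrow> (\<exists>Gs. integral_decomposition G Gs)"
    using prime_integral_decomposition[OF assms] integral_of_decomposition[OF assms(2)] by blast
  have "signed_diagonalizable G \<Longrightarrow> laplacian_integral G"
    using signed_complete_imp_integral[OF assms(2)] signed_diagonalizable_iff[OF assms(2)] by blast
  then show ?thesis
    using 1 signed_diagonalizable_decomposition[OF assms(2)] unfolding size_vector_def by blast
qed

end
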